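(* Let $\{A_n\}_n$ be a matrix-sequence with $A_n\in\mathbb{C}^{d_n\times d_n'}$, where $(d_n)$ and $(d_n')$ are monotonically increasing sequences of positive integers, and write $N_n=d_n\wedge d_n'=\min(d_n,d_n')$. Let $D\subseteq\mathbb{R}^d$ ($d\ge 1$) be a measurable set, possibly unbounded and possibly of infinite Lebesgue measure, and let $f:D\to\mathbb{C}^{p_1\times p_2}$ ($p_1,p_2\ge1$) be measurable, with $p=p_1\wedge p_2$. Let $\{D_t\}_{t>0}$ be an exhaustion of $D$, i.e. measurable sets with $D_{t+1}\supset D_t$ for every $t>0$ and $\bigcup_{t>0}D_t=D$. Assume there exist matrix-sequences $\{B_{n,t}\}_n$ ($t>0$), with $B_{n,t}\in\mathbb{C}^{d_n\times d_n'}$, such that $\{\{B_{n,t}\}_n\}_{t}$ is an approximating class of sequences (a.c.s.) for $\{A_n\}_n$, and, for each $t$, measurable functions $f_t:D_t\to\mathbb{C}^{p_1\times p_2}$ with $0<\mu(D_t)<\infty$ such that $\{B_{n,t}\}_n\sim_\sigma(f_t,D_t)$, i.e. $$\lim_{n\to\infty}\sum_{j=1}^{N_n}\frac{F(\sigma_j(B_{n,t}))}{N_n}=\frac{1}{\mu(D_t)}\int_{D_t}\sum_{k=1}^p\frac{F(\sigma_k(f_t(s)))}{p}\,ds=:\alpha_t(F)\qquad\forall F\in C_c(\mathbb{R}).$$ Assume that for every $F\in C_c(\mathbb{R})$ the limit $\lim_{t\to\infty}\alpha_t(F)=\alpha(F)$ exists. Then $$\lim_{n\to\infty}\sum_{j=1}^{N_n}\frac{F(\sigma_j(A_n))}{N_n}=\alpha(F)\qquad\forall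 F\in C_c(\mathbb{R}).$$ If in addition $f_t^E\to f$ almost everywhere in $D$ as $t\to\infty$, where $f_t^E(s)=f_t(s)$ for $s\in D_t$ and $f_t^E(s)=0$ otherwise, and $\mu(D)<\infty$, then $$\alpha(F)=\frac{1}{\mu(D)}\int_D\sum_{k=1}^p\frac{F(\sigma_k(f(s)))}{p}\,ds\qquad\forall F\in C_c(\mathbb{R}).$$
   Context: $\mu$ denotes Lebesgue measure; $\sigma_j(X)$ are the singular values of a matrix $X$ and $\sigma_k(f(s))$, $k=1,\dots,p$, the singular values of the matrix $f(s)$. A sequence of matrix-sequences $\{\{B_{n,t}\}_n\}_t$ with $B_{n,t}$ of the same size $d_n\times d_n'$ as $A_n$ is an approximating class of sequences (a.c.s.) for $\{A_n\}_n$ if for every $t$ there exists $n_t$ such that for $n>n_t$ one has $A_n=B_{n,t}+R_{n,t}+N_{n,t}$ with $\operatorname{rank}(R_{n,t})\le c(t)\,(d_n\wedge d_n')$ and $\|N_{n,t}\|\le\omega(t)$ (spectral norm), where $n_t,c(t),\omega(t)$ depend only on $t$ and $\lim_{t\to\infty}c(t)=\lim_{t\to\infty}\omega(t)=0$. *)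

theory Defs
  imports "HOL-Analysis.Analysis" "Jordan_Normal_Form.Char_Poly" "Jordan_Normal_Form.DL_Rank"
begin

definition cadj :: "complex mat \<Rightarrow> complex mat" where
  "cadj A = mat (dim_col A) (dim_row A) (\<lambda>(i,j). cnj (A $$ (j,i)))"

(* singular values of an m x n complex matrix: the min(m,n) nonnegative square roots of the
   eigenvalues (with multiplicity) of the smaller Gram matrix A A^H (if m <= n) or A^H A *)
definition sing_vals :: "complex mat \<Rightarrow> real multiset" where
  "sing_vals A = image_mset (\<lambda>z. sqrt (Re z))
     (proots (char_poly (if dim_row A \<le> dim_col A then A * cadj A else cadj A * A)))"

(* spectral norm = largest singular value (0 for empty matrices) *)
definition spec_norm :: "complex mat \<Rightarrow> real" where
  "spec_norm A = Max (insert 0 (set_mset (sing_vals A)))"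

definition mrank :: "complex mat \<Rightarrow> nat" where
  "mrank A = vec_space.rank (dim_row A) A"

definition Cc :: "(real \<Rightarrow> complex) set" where
  "Cc = {F. continuous_on UNIV F \<and> compact (closure {x. F x \<noteq> 0})}"

definition acs :: "(nat \<Rightarrow> nat \<Rightarrow> complex mat) \<Rightarrow> (nat \<Rightarrow> complex mat)
                    \<Rightarrow> (nat \<Rightarrow> nat) \<Rightarrow> (nat \<Rightarrow> nat) \<Rightarrow> bool" where
  "acs B A d d' \<longleftrightarrow>
     (\<exists>c \<omega> :: nat \<Rightarrow> real. c \<longlonglongrightarrow> 0 \<and> \<omega> \<longlonglongrightarrow> 0 \<and>
        (\<forall>t>0. \<exists>nt. \<forall>n>nt. \<exists>R Nm.
            R \<in> carrier_mat (d n) (d' n) \<and> Nm \<in> carrier_mat (d n) (d' n) \<and>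
            A n = B n t + R + Nm \<and>
            real (mrank R) \<le> c t * real (min (d n) (d' n)) \<and>
            spec_norm Nm \<le> \<omega> t))"

definition mat_measurable_on :: "'d::euclidean_space set \<Rightarrow> nat \<Rightarrow> nat \<Rightarrow> ('d \<Rightarrow> complex mat) \<Rightarrow> bool" where
  "mat_measurable_on S p1 p2 g \<longleftrightarrow>
     (\<forall>s\<in>S. g s \<in> carrier_mat p1 p2) \<and>
     (\<forall>i<p1. \<forall>j<p2. set_borel_measurable lebesgue S (\<lambda>s. g s $$ (i,j)))"

definition sv_avg :: "(real \<Rightarrow> complex) \<Rightarrow> complex mat \<Rightarrow> complex" where
  "sv_avg F X = (\<Sum>x\<in>#sing_vals X. F x) / of_nat (min (dim_row X) (dim_col X))"

end

theory Submission
  imports Defs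
begin

text \<open>
  The number of singular values of a matrix above a level \<open>x\<close> is the largest dimension of a
  subspace on which the matrix stretches every nonzero vector by more than \<open>x\<close>. A perturbation of
  rank \<open>r\<close> plus one of norm at most \<open>w\<close> therefore changes this counting function by at most \<open>r\<close>,
  up to a shift of the level by \<open>w\<close>, in both directions. Hence sums of a bounded monotone
  Lipschitz function over the singular values are stable; since every \<open>F\<close> in \<open>Cc\<close> is on the
  nonnegative half line a uniform limit of linear combinations of such functions, so are the
  averages of \<open>F\<close>, and the first claim is an \<open>\<epsilon>/4\<close> argument. The same stability makes
  \<open>sv_avg F\<close> a bounded continuous function of the matrix entries, so the second claim is
  dominated convergence.
\<close>

section \<open>Adjoints and linear systems\<close>

unbundle no vec_syntax
unbundle no inner_syntax
hide_const (open) Finite_Cartesian_Product.vec Finite_Cartesian_Product.mat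

text \<open>A perturbation of small rank can move a singular value arbitrarily far, so no estimate
  for each value separately can hold; it can only displace their order, and a bounded summand makes
  the r displaced values cheap. As \<open>sing_vals\<close> is defined by roots of a characteristic
  polynomial, the link to vectors is an orthonormal eigenbasis of the Gram matrix, in whose
  coordinates the squared norms of v and X v are sums of squares with weights 1 and l_i^2. Subspaces
  are never formed: each one is given by the vanishing of some coordinates, and intersecting them
  means counting equations against unknowns. The rank of R enters as the number of equations Q v = 0
  in a factorization R = C Q. The constant K of the stability estimate depends on F and \<epsilon>
  only, not on the sizes of the matrices; this is why t can be fixed before n. For the integrals,
  convergence of matrices is entrywise, and measurability passes through matrix-valued simple
  functions.\<close>

lemma mult_mat_vec_index:
  assumes "M \<in> carrier_mat m n" "v \<in> carrier_vec n" "i < m"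
  shows "(M *\<^sub>v v) $ i = (\<Sum>j<n. M $$ (i,j) * v $ j)"
  using assms by (auto simp: scalar_prod_def atLeast0LessThan intro!: sum.cong)

lemma mult_mat_index:
  assumes "M \<in> carrier_mat m n" "K \<in> carrier_mat n l" "i < m" "j < l"
  shows "(M * K) $$ (i,j) = (\<Sum>k<n. M $$ (i,k) * K $$ (k,j))"
  using assms by (auto simp: scalar_prod_def atLeast0LessThan intro!: sum.cong)

lemma cscalar_prod_sum:
  fixes v w :: "complex vec"
  assumes "w \<in> carrier_vec n"
  shows "v \<bullet>c w = (\<Sum>i<n. v $ i * cnj (w $ i))"
  using assms by (auto simp: scalar_prod_def atLeast0LessThan intro!: sum.cong)

lemma cadj_carrier [simp, intro]: "M \<in> carrier_mat m n \<Longrightarrow> cadj M \<in> carrier_mat n m"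
  unfolding cadj_def by auto

lemma cadj_dim [simp]: "dim_row (cadj M) = dim_col M" "dim_col (cadj M) = dim_row M"
  unfolding cadj_def by auto

lemma cadj_index:
  "M \<in> carrier_mat m n \<Longrightarrow> i < n \<Longrightarrow> j < m \<Longrightarrow> cadj M $$ (i,j) = cnj (M $$ (j,i))"
  unfolding cadj_def by auto

lemma cadj_cadj [simp]: "cadj (cadj M) = M"
  unfolding cadj_def by (intro eq_matI) auto

lemma cadj_add:
  "M \<in> carrier_mat m n \<Longrightarrow> K \<in> carrier_mat m n \<Longrightarrow> cadj (M + K) = cadj M + cadj K"
  unfolding cadj_def by (intro eq_matI) auto

lemma cadj_mult:
  assumes "M \<in> carrier_mat m n" "K \<in> carrier_mat n l"
  shows "cadj (M * K) = cadj K * cadj M"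
proof (rule eq_matI)
  fix i j assume "i < dim_row (cadj K * cadj M)" "j < dim_col (cadj K * cadj M)"
  hence ij: "i < l" "j < m" using assms by auto
  have "cadj (M * K) $$ (i,j) = cnj (\<Sum>k<n. M $$ (j,k) * K $$ (k,i))"
    using assms ij by (simp add: cadj_index[of _ m l] mult_mat_index[of _ m n _ l] del: index_mult_mat)
  also have "\<dots> = (\<Sum>k<n. cadj K $$ (i,k) * cadj M $$ (k,j))"
    using assms ij by (auto simp: cadj_index[of M m n] cadj_index[of K n l] intro!: sum.cong)
  also have "\<dots> = (cadj K * cadj M) $$ (i,j)"
    using assms ij mult_mat_index[of "cadj K" l n "cadj M" m i j] by auto
  finally show "cadj (M * K) $$ (i,j) = (cadj K * cadj M) $$ (i,j)" .
qed (use assms in auto)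

lemma cscalar_prod_cadj:
  assumes M: "M \<in> carrier_mat m n" and v: "v \<in> carrier_vec n" and w: "w \<in> carrier_vec m"
  shows "(M *\<^sub>v v) \<bullet>c w = v \<bullet>c (cadj M *\<^sub>v w)"
proof -
  have "(M *\<^sub>v v) \<bullet>c w = (\<Sum>i<m. (\<Sum>j<n. M $$ (i,j) * v $ j) * cnj (w $ i))"
    using assms by (subst cscalar_prod_sum[OF w]) (simp add: mult_mat_vec_index[of _ m n] del: index_mult_mat_vec)
  also have "\<dots> = (\<Sum>j<n. \<Sum>i<m. M $$ (i,j) * v $ j * cnj (w $ i))"
    unfolding sum_distrib_right by (rule sum.swap)
  also have "\<dots> = (\<Sum>j<n. v $ j * cnj ((cadj M *\<^sub>v w) $ j))"
    using assms by (auto simp: mult_mat_vec_index[of "cadj M" n m] cadj_index[of M m n] sum_distrib_left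
        ac_simps intro!: sum.cong simp del: index_mult_mat_vec)
  also have "\<dots> = v \<bullet>c (cadj M *\<^sub>v w)"
    using assms by (subst cscalar_prod_sum[of _ n]) (auto intro!: mult_mat_vec_carrier)
  finally show ?thesis .
qed

text \<open>Padding with zero rows makes the system square without changing its solutions. Row k
  exists because k < n and is zero, so the determinant vanishes. This lemma carries all the
  dimension arguments below.\<close>

lemma homogeneous_system_nontrivial:
  fixes M :: "'a :: field mat"
  assumes M: "M \<in> carrier_mat k n" and "k < n"
  obtains v where "v \<in> carrier_vec n" "v \<noteq> 0\<^sub>v n" "M *\<^sub>v v = 0\<^sub>v k"
proof -
  define P where "P = mat n n (\<lambda>(i,j). if i < k then M $$ (i,j) else 0)"
  have P: "P \<in> carrier_mat n n" unfolding P_def by auto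
  have "P = mat\<^sub>r n n (\<lambda>i. if i = k then 0\<^sub>v n else row P i)"
    using \<open>k < n\<close> unfolding P_def by (intro eq_matI) auto
  also have "det \<dots> = 0" by (rule det_row_0[OF \<open>k < n\<close>]) (auto simp: P_def)
  finally have "det P = 0" .
  then obtain v where v: "v \<in> carrier_vec n" "v \<noteq> 0\<^sub>v n" "P *\<^sub>v v = 0\<^sub>v n"
    using det_0_iff_vec_prod_zero[OF P] by auto
  have "M *\<^sub>v v = 0\<^sub>v k"
  proof (rule eq_vecI)
    fix i assume "i < dim_vec (0\<^sub>v k :: 'a vec)"
    hence i: "i < k" by auto
    have "(M *\<^sub>v v) $ i = (P *\<^sub>v v) $ i"
      using v(1) M P i \<open>k < n\<close>
      by (auto simp: mult_mat_vec_index[of _ k n] mult_mat_vec_index[of _ n n] P_def simp del: index_mult_mat_vec intro!: sum.cong)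
    thus "(M *\<^sub>v v) $ i = 0\<^sub>v k $ i" using v i \<open>k < n\<close> by simp
  qed (use M in auto)
  thus ?thesis using that v by blast
qed


text \<open>The eigenvector lies in the Krylov space of \<open>v\<close>, hence in every \<open>A\<close>-invariant subspace
  containing \<open>v\<close>: split linear factors off a polynomial \<open>p\<close> with \<open>p(A) v = 0\<close>.\<close>

lemma krylov_eigenvector:
  fixes A :: "complex mat"
  assumes A: "A \<in> carrier_mat n n" and v: "v \<in> carrier_vec n" "v \<noteq> 0\<^sub>v n"
  obtains c N e w where "w = vec n (\<lambda>i. \<Sum>j<N. c j * (((*\<^sub>v) A ^^ j) v) $ i)"
    "w \<noteq> 0\<^sub>v n" "A *\<^sub>v w = e \<cdot>\<^sub>v w"
proof -
  define pw where "pw j = ((*\<^sub>v) A ^^ j) v" for j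
  have pw: "pw j \<in> carrier_vec n" for j
    by (induction j) (use A v in \<open>auto simp: pw_def\<close>)
  define N where "N = Suc (Suc n)"
  \<comment> \<open>\<open>ev p\<close> is p(A) v as long as the degree of p is below
    \<open>N\<close>. The fixed length lets one sum serve a polynomial and all its factors; the
    annihilating polynomial found below has degree at most n.\<close>
  define ev where "ev p = vec n (\<lambda>i. \<Sum>j<N. coeff p j * pw j $ i)" for p :: "complex poly"
  have step: "ev ([:-a,1:] * q) = A *\<^sub>v ev q - a \<cdot>\<^sub>v ev q" if "degree q < Suc n" for a q
  proof (rule eq_vecI)
    fix i assume "i < dim_vec (A *\<^sub>v ev q - a \<cdot>\<^sub>v ev q)"
    hence i: "i < n" by (simp add: ev_def)
    have q0: "coeff q (Suc n) = 0" using that by (simp add: coeff_eq_0)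
    have "(A *\<^sub>v ev q) $ i = (\<Sum>k<n. A $$ (i,k) * (\<Sum>j<N. coeff q j * pw j $ k))"
      using A i by (subst mult_mat_vec_index[of _ n n]) (auto simp: ev_def)
    also have "\<dots> = (\<Sum>j<N. coeff q j * (\<Sum>k<n. A $$ (i,k) * pw j $ k))"
      unfolding sum_distrib_left by (subst sum.swap) (simp add: ac_simps)
    also have "\<dots> = (\<Sum>j<N. coeff q j * pw (Suc j) $ i)"
      using A i pw mult_mat_vec_index[OF A pw i] by (simp add: pw_def)
    also have "\<dots> = (\<Sum>j<Suc n. coeff q j * pw (Suc j) $ i)"
      unfolding N_def by (subst sum.lessThan_Suc) (simp add: q0)
    also have "\<dots> = (\<Sum>j<N. coeff (pCons 0 q) j * pw j $ i)"
      unfolding N_def by (subst (2) sum.lessThan_Suc_shift) simp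
    finally have *: "(A *\<^sub>v ev q) $ i = \<dots>" .
    show "ev ([:-a,1:] * q) $ i = (A *\<^sub>v ev q - a \<cdot>\<^sub>v ev q) $ i"
      using i A * by (simp add: ev_def sum_distrib_left sum_subtractf algebra_simps sum.distrib 
          del: index_mult_mat_vec)
  qed (use A in \<open>auto simp: ev_def\<close>)
  \<comment> \<open>For a root a of p with cofactor q, either q annihilates v as well and has
    smaller degree, or \<open>ev q\<close> is an eigenvector for a. The descent must end in the
    second case: a nonzero constant does not annihilate v.\<close>
  have main: "\<exists>q e. ev q \<noteq> 0\<^sub>v n \<and> A *\<^sub>v ev q = e \<cdot>\<^sub>v ev q"
    if "p \<noteq> 0" "degree p < N" "ev p = 0\<^sub>v n" for p
    using that
  proof (induction "degree p" arbitrary: p)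
    case 0
    then obtain c where p: "p = [:c:]" by (auto elim: degree_eq_zeroE)
    have "ev p = c \<cdot>\<^sub>v v" 
    proof (rule eq_vecI)
      fix i assume "i < dim_vec (c \<cdot>\<^sub>v v)"
      hence "i < n" using v by auto
      thus "ev p $ i = (c \<cdot>\<^sub>v v) $ i" using v unfolding ev_def p N_def
        by (subst index_vec, simp, subst sum.lessThan_Suc_shift) (simp add: pw_def)
    qed (use v in \<open>auto simp: ev_def\<close>)
    moreover have "c \<noteq> 0" using 0 p by auto
    ultimately have "v = 0\<^sub>v n" using 0(4) v(1) by (auto simp: vec_eq_iff)
    thus ?case using v by simp
  next
    case (Suc d)
    have "\<not> constant (poly p)" using Suc.hyps by (simp add: constant_degree)
    then obtain a where "poly p a = 0" using fundamental_theorem_of_algebra by blast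
    then obtain q where pq: "p = [:-a,1:] * q" by (auto simp: poly_eq_0_iff_dvd)
    have q0: "q \<noteq> 0" using Suc.prems pq by auto
    have dq: "degree q = d" using Suc.hyps q0 unfolding pq by (subst (asm) degree_mult_eq) auto
    show ?case
    proof (cases "ev q = 0\<^sub>v n")
      case True
      thus ?thesis using Suc.hyps(1)[of q] dq q0 Suc.hyps(2) Suc.prems by auto
    next
      case False
      have "A *\<^sub>v ev q - a \<cdot>\<^sub>v ev q = 0\<^sub>v n"
        using step[of q a] Suc.prems Suc.hyps dq pq by (auto simp: N_def)
      hence "A *\<^sub>v ev q = a \<cdot>\<^sub>v ev q"
        using A by (intro eq_vecI) (auto simp: vec_eq_iff ev_def)
      thus ?thesis using False by blast
    qed
  qed
  \<comment> \<open>The n + 1 Krylov vectors live in dimension n, so they are dependent; a kernel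
    vector of \<open>K\<close> lists the coefficients of an annihilating polynomial.\<close>
  define K where "K = mat n (Suc n) (\<lambda>(i,j). pw j $ i)"
  have "K \<in> carrier_mat n (Suc n)" unfolding K_def by auto
  then obtain c where c: "c \<in> carrier_vec (Suc n)" "c \<noteq> 0\<^sub>v (Suc n)" "K *\<^sub>v c = 0\<^sub>v n"
    using homogeneous_system_nontrivial by (metis lessI)
  define p where "p = Poly (list_of_vec c)"
  have cp: "coeff p j = (if j < Suc n then c $ j else 0)" for j
    using c by (auto simp: p_def nth_default_def list_of_vec_index)
  obtain j where j: "j < Suc n" "c $ j \<noteq> 0" using c by (auto simp: vec_eq_iff)
  hence "p \<noteq> 0" using cp by (metis coeff_0)
  moreover have "degree p < N"
    unfolding N_def by (rule le_less_trans[of _ n]) (auto intro!: degree_le simp: cp)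
  moreover have "ev p = 0\<^sub>v n"
  proof (rule eq_vecI)
    fix i assume "i < dim_vec (0\<^sub>v n :: complex vec)"
    hence i: "i < n" by simp
    have "ev p $ i = (\<Sum>j<Suc n. K $$ (i,j) * c $ j)"
      using i by (simp add: ev_def N_def cp K_def mult.commute)
    also have "\<dots> = (K *\<^sub>v c) $ i"
      by (rule mult_mat_vec_index[symmetric]) (use i c in \<open>auto simp: K_def\<close>)
    finally show "ev p $ i = 0\<^sub>v n $ i" using c by simp
  qed (auto simp: ev_def)
  ultimately obtain q e where "ev q \<noteq> 0\<^sub>v n" "A *\<^sub>v ev q = e \<cdot>\<^sub>v ev q" using main by blast
  thus ?thesis using that unfolding ev_def pw_def by blast
qed

section \<open>The spectral theorem for Hermitian matrices\<close>

definition cnorm :: "complex vec \<Rightarrow> real" where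
  "cnorm v = L2_set (\<lambda>i. cmod (v $ i)) {..<dim_vec v}"

lemma cnorm_nonneg [simp]: "0 \<le> cnorm v"
  by (simp add: cnorm_def)

lemma cnorm_sq: "(cnorm v)\<^sup>2 = (\<Sum>i<dim_vec v. (cmod (v $ i))\<^sup>2)"
  by (simp add: cnorm_def L2_set_def sum_nonneg)

lemma cscalar_prod_self: "v \<bullet>c v = complex_of_real ((cnorm v)\<^sup>2)"
  unfolding cnorm_sq
  by (subst cscalar_prod_sum[of _ "dim_vec v"]) (auto simp: complex_norm_square[symmetric])

lemma cnorm_eq_0_iff: "v \<in> carrier_vec n \<Longrightarrow> cnorm v = 0 \<longleftrightarrow> v = 0\<^sub>v n"
  by (auto simp: cnorm_def L2_set_eq_0_iff vec_eq_iff)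

lemma cnorm_triangle:
  assumes "v \<in> carrier_vec n" "w \<in> carrier_vec n"
  shows "cnorm (v + w) \<le> cnorm v + cnorm w"
proof -
  have "cnorm (v + w) \<le> L2_set (\<lambda>i. cmod (v $ i) + cmod (w $ i)) {..<n}"
    using assms unfolding cnorm_def by (auto intro!: L2_set_mono norm_triangle_ineq)
  also have "\<dots> \<le> cnorm v + cnorm w"
    using assms L2_set_triangle_ineq[of "\<lambda>i. cmod (v $ i)" "\<lambda>i. cmod (w $ i)" "{..<n}"]
    unfolding cnorm_def by auto
  finally show ?thesis .
qed

lemma cnorm_smult: "cnorm (c \<cdot>\<^sub>v v) = cmod c * cnorm v"
  unfolding cnorm_def by (auto simp: norm_mult L2_set_right_distrib intro!: L2_set_cong)

lemma cscalar_prod_commute: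
  assumes "v \<in> carrier_vec n" "w \<in> carrier_vec n"
  shows "v \<bullet>c w = cnj (w \<bullet>c v)"
  using assms by (simp add: cscalar_prod_sum[of _ n] mult.commute)

lemma hermitian_eigenvalue_real:
  assumes A: "A \<in> carrier_mat n n" "cadj A = A"
    and w: "w \<in> carrier_vec n" "w \<noteq> 0\<^sub>v n" "A *\<^sub>v w = e \<cdot>\<^sub>v w"
  shows "e \<in> \<real>"
proof -
  have "e * (w \<bullet>c w) = (A *\<^sub>v w) \<bullet>c w" using w by simp
  also have "\<dots> = w \<bullet>c (A *\<^sub>v w)" using cscalar_prod_cadj[OF A(1) w(1) w(1)] A by simp
  also have "\<dots> = cnj e * (w \<bullet>c w)" using w(1) unfolding w(3) by (simp add: conjugate_smult_vec)
  finally have "e = cnj e" using w cnorm_eq_0_iff[OF w(1)] by (simp add: cscalar_prod_self)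
  thus ?thesis by (simp add: Reals_cnj_iff)
qed

text \<open>Orthogonality to k < n vectors is a system with a nonzero solution v. Since A is
  Hermitian and the chosen vectors are eigenvectors, all powers of A applied to v stay orthogonal to
  them, and so does the eigenvector that \<open>krylov_eigenvector\<close> builds from these
  powers.\<close>

lemma hermitian_orthonormal_eigenvectors:
  assumes A: "A \<in> carrier_mat n n" "cadj A = A" and "k \<le> n"
  shows "\<exists>u l. (\<forall>i<k. u i \<in> carrier_vec n \<and> A *\<^sub>v u i = complex_of_real (l i) \<cdot>\<^sub>v u i)
    \<and> (\<forall>i<k. \<forall>j<k. u i \<bullet>c u j = (if i = j then 1 else 0))"
  using \<open>k \<le> n\<close>
proof (induction k)
  case 0
  show ?case by auto
next
  case (Suc k)
  then obtain u l where u: "\<And>i. i < k \<Longrightarrow> u i \<in> carrier_vec n"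
      "\<And>i. i < k \<Longrightarrow> A *\<^sub>v u i = complex_of_real (l i) \<cdot>\<^sub>v u i"
      "\<And>i j. i < k \<Longrightarrow> j < k \<Longrightarrow> u i \<bullet>c u j = (if i = j then 1 else 0)"
    by (metis Suc_leD)
  define M where "M = mat k n (\<lambda>(i,j). cnj (u i $ j))"
  have M: "M \<in> carrier_mat k n" by (simp add: M_def)
  obtain v where v: "v \<in> carrier_vec n" "v \<noteq> 0\<^sub>v n" "M *\<^sub>v v = 0\<^sub>v k"
    using homogeneous_system_nontrivial[OF M] Suc.prems by auto
  have orth0: "v \<bullet>c u i = 0" if "i < k" for i
  proof -
    have "v \<bullet>c u i = (\<Sum>j<n. M $$ (i,j) * v $ j)"
      using that by (subst cscalar_prod_sum[OF u(1)[OF that]]) (simp add: M_def mult.commute)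
    also have "\<dots> = (M *\<^sub>v v) $ i" using mult_mat_vec_index[OF M v(1) that] by simp
    finally show ?thesis using v that by simp
  qed
  define pw where "pw j = ((*\<^sub>v) A ^^ j) v" for j
  have pw: "pw j \<in> carrier_vec n" for j
    by (induction j) (use A v in \<open>auto simp: pw_def\<close>)
  have orth: "pw j \<bullet>c u i = 0" if "i < k" for i j
  proof (induction j)
    case 0
    show ?case using orth0[OF that] by (simp add: pw_def)
  next
    case (Suc j)
    have "pw (Suc j) \<bullet>c u i = (A *\<^sub>v pw j) \<bullet>c u i" by (simp add: pw_def)
    also have "\<dots> = pw j \<bullet>c (complex_of_real (l i) \<cdot>\<^sub>v u i)"
      using cscalar_prod_cadj[OF A(1) pw u(1)[OF that]] A(2) u(2)[OF that] by simp
    also have "\<dots> = of_real (l i) * (pw j \<bullet>c u i)"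
      using pw[of j] u(1)[OF that] by (simp add: conjugate_smult_vec)
    finally show ?case using Suc by simp
  qed
  obtain c N e w where w: "w = vec n (\<lambda>i. \<Sum>j<N. c j * pw j $ i)"
    "w \<noteq> 0\<^sub>v n" "A *\<^sub>v w = e \<cdot>\<^sub>v w"
    by (rule krylov_eigenvector[OF A(1) v(1,2), folded pw_def])
  have wc: "w \<in> carrier_vec n" unfolding w(1) by simp
  have wu: "w \<bullet>c u i = 0" if "i < k" for i
  proof -
    have "w \<bullet>c u i = (\<Sum>r<n. \<Sum>j<N. c j * (pw j $ r * cnj (u i $ r)))"
      using that by (subst cscalar_prod_sum[OF u(1)[OF that]]) 
        (simp add: w(1) sum_distrib_left sum_distrib_right ac_simps)
    also have "\<dots> = (\<Sum>j<N. c j * (pw j \<bullet>c u i))"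
      by (subst sum.swap) (simp add: cscalar_prod_sum[OF u(1)[OF that]] sum_distrib_left)
    finally show ?thesis using orth[OF that] by simp
  qed
  obtain lam where lam: "e = complex_of_real lam"
    using hermitian_eigenvalue_real[OF A wc w(2,3)] by (auto elim: Reals_cases)
  define x where "x = complex_of_real (1 / cnorm w) \<cdot>\<^sub>v w"
  have x: "x \<in> carrier_vec n" using wc by (simp add: x_def)
  have Ax: "A *\<^sub>v x = complex_of_real lam \<cdot>\<^sub>v x"
    unfolding x_def using A wc w(3) lam by (simp add: mult_mat_vec smult_smult_assoc mult.commute)
  have "cnorm x = 1" using w(2) cnorm_eq_0_iff[OF wc] by (simp add: x_def cnorm_smult norm_divide)
  hence xx: "x \<bullet>c x = 1" by (simp add: cscalar_prod_self)
  have xu: "x \<bullet>c u i = 0" if "i < k" for i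
    using wu[OF that] u(1)[OF that] wc by (simp add: x_def)
  have ux: "u i \<bullet>c x = 0" if "i < k" for i
    using xu[OF that] cscalar_prod_commute[OF u(1)[OF that] x] by simp
  show ?case
  proof (intro exI conjI allI impI)
    fix i assume i: "i < Suc k"
    show "(if i = k then x else u i) \<in> carrier_vec n" using i u x by auto
    show "A *\<^sub>v (if i = k then x else u i) = complex_of_real (if i = k then lam else l i) \<cdot>\<^sub>v (if i = k then x else u i)"
      using i u Ax by auto
    fix j assume j: "j < Suc k"
    show "(if i = k then x else u i) \<bullet>c (if j = k then x else u j) = (if i = j then 1 else 0)"
      using i j u(3) xx xu ux by auto
  qed
qed

text \<open>\<open>U\<close> is the adjoint of the matrix of eigenvectors, so that U v is the
  coordinate vector of v. The last conclusion keeps the multiplicities and uses the same l as the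
  diagonal; this ties roots to coordinates.\<close>

lemma hermitian_diagonalization:
  assumes A: "A \<in> carrier_mat n n" "cadj A = A"
  obtains U l where "U \<in> carrier_mat n n" "cadj U * U = 1\<^sub>m n"
    "A = cadj U * mat n n (\<lambda>(i,j). if i = j then complex_of_real (l i) else 0) * U"
    "proots (char_poly A) = image_mset (\<lambda>i. complex_of_real (l i)) (mset_set {..<n})"
proof -
  obtain u l where u: "\<And>i. i < n \<Longrightarrow> u i \<in> carrier_vec n"
      "\<And>i. i < n \<Longrightarrow> A *\<^sub>v u i = complex_of_real (l i) \<cdot>\<^sub>v u i"
      "\<And>i j. i < n \<Longrightarrow> j < n \<Longrightarrow> u i \<bullet>c u j = (if i = j then 1 else 0)"
    using hermitian_orthonormal_eigenvectors[OF A order_refl] by metis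
  define V where "V = mat n n (\<lambda>(i,j). u j $ i)"
  define U where "U = cadj V"
  define L where "L = mat n n (\<lambda>(i,j). if i = j then complex_of_real (l i) else 0)"
  have V: "V \<in> carrier_mat n n" and L: "L \<in> carrier_mat n n" unfolding V_def L_def by auto
  hence U: "U \<in> carrier_mat n n" unfolding U_def by auto
  have UV: "U * V = 1\<^sub>m n"
  proof (rule eq_matI)
    fix i j assume "i < dim_row (1\<^sub>m n :: complex mat)" "j < dim_col (1\<^sub>m n :: complex mat)"
    hence ij: "i < n" "j < n" by auto
    have "(U * V) $$ (i,j) = (\<Sum>k<n. u j $ k * cnj (u i $ k))"
      using ij V U by (subst mult_mat_index[of _ n n _ n]) 
        (auto simp: U_def cadj_index[OF V], auto simp: V_def mult.commute)
    also have "\<dots> = u j \<bullet>c u i" using cscalar_prod_sum[OF u(1)[OF ij(1)]] by simp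
    finally show "(U * V) $$ (i,j) = 1\<^sub>m n $$ (i,j)" using u(3) ij by auto
  qed (use U V in auto)
  have VU: "V * U = 1\<^sub>m n" by (rule mat_mult_left_right_inverse[OF U V UV])
  have AV: "A * V = V * L"
  proof (rule eq_matI)
    fix i j assume "i < dim_row (V * L)" "j < dim_col (V * L)"
    hence ij: "i < n" "j < n" using V L by auto
    have "(A * V) $$ (i,j) = (\<Sum>k<n. A $$ (i,k) * u j $ k)"
      using ij V A by (subst mult_mat_index[of _ n n _ n]) (auto simp: V_def)
    also have "\<dots> = (A *\<^sub>v u j) $ i" using mult_mat_vec_index[OF A(1) u(1)[OF ij(2)] ij(1)] by simp
    also have "\<dots> = of_real (l j) * u j $ i" using u(1,2)[OF ij(2)] ij by simp
    also have "\<dots> = (V * L) $$ (i,j)"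
      using ij V L by (subst mult_mat_index[of _ n n _ n]) (simp_all add: V_def L_def if_distrib sum.delta cong: if_cong)
    finally show "(A * V) $$ (i,j) = (V * L) $$ (i,j)" .
  qed (use A V L in auto)
  have AL: "A = V * L * U"
  proof -
    have "A = A * (V * U)" using VU A by simp
    also have "\<dots> = A * V * U" using A V U by (simp add: assoc_mult_mat[of _ n n _ n _ n])
    finally show ?thesis using AV by simp
  qed
  have "similar_mat A L"
    by (rule similar_matI[of _ _ V U n]) (use A V L U UV VU AL in auto)
  hence "char_poly A = char_poly L" by (rule char_poly_similar)
  also have "\<dots> = (\<Prod>a\<leftarrow>diag_mat L. [:-a,1:])"
    by (rule char_poly_upper_triangular[OF L]) (auto simp: L_def)
  finally have cp: "char_poly A = (\<Prod>a\<leftarrow>diag_mat L. [:-a,1:])" .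
  have "0 \<notin> set (map (\<lambda>a. [:-a,1:]) (diag_mat L))" by auto
  from proots_prod_list[OF this] have "proots (char_poly A) = mset (diag_mat L)"
    unfolding cp by (simp add: o_def)
  also have "diag_mat L = map (\<lambda>i. complex_of_real (l i)) [0..<n]"
    unfolding diag_mat_def L_def by auto
  finally have "proots (char_poly A) = image_mset (\<lambda>i. complex_of_real (l i)) (mset_set {..<n})"
    by (simp add: atLeast0LessThan)
  moreover have "V = cadj U" by (simp add: U_def)
  ultimately show ?thesis using that[of U l] U VU AL unfolding L_def by simp
qed

section \<open>Perturbation of singular values\<close>

text \<open>Unlike \<open>sing_vals\<close>, padded with zeros to \<open>dim_col X\<close> elements if \<open>X\<close> has fewer rows than
  columns.\<close>

definition col_sing_vals :: "complex mat \<Rightarrow> real multiset" where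
  "col_sing_vals X = image_mset (\<lambda>z. sqrt (Re z)) (proots (char_poly (cadj X * X)))"

lemma sing_vals_eq_col_sing_vals:
  "sing_vals X = col_sing_vals (if dim_row X \<le> dim_col X then cadj X else X)"
  by (simp add: sing_vals_def col_sing_vals_def)

text \<open>This is the only interface between the multiset and vectors: one family l lists the
  singular values and weights the coordinates. The unit vectors in the last clause are the
  eigenvectors of the Gram matrix; they show that each l i is nonnegative and attained.\<close>

lemma col_sing_vals_spectral:
  assumes X: "X \<in> carrier_mat m n"
  obtains U l where "U \<in> carrier_mat n n"
    "col_sing_vals X = image_mset l (mset_set {..<n})"
    "\<forall>v\<in>carrier_vec n. (cnorm v)\<^sup>2 = (\<Sum>i<n. (cmod ((U *\<^sub>v v) $ i))\<^sup>2)"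
    "\<forall>v\<in>carrier_vec n. (cnorm (X *\<^sub>v v))\<^sup>2 = (\<Sum>i<n. (l i)\<^sup>2 * (cmod ((U *\<^sub>v v) $ i))\<^sup>2)"
    "\<forall>i<n. \<exists>v\<in>carrier_vec n. cnorm v = 1 \<and> cnorm (X *\<^sub>v v) = l i"
proof -
  let ?G = "cadj X * X"
  have cX: "cadj X \<in> carrier_mat n m" using X by simp
  have G: "?G \<in> carrier_mat n n" "cadj ?G = ?G" using X cX by (auto simp: cadj_mult[OF cX X])
  obtain U l where U: "U \<in> carrier_mat n n" "cadj U * U = 1\<^sub>m n"
    and GL: "?G = cadj U * mat n n (\<lambda>(i,j). if i = j then complex_of_real (l i) else 0) * U"
    and pr: "proots (char_poly ?G) = image_mset (\<lambda>i. complex_of_real (l i)) (mset_set {..<n})"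
    by (rule hermitian_diagonalization[OF G])
  define L where "L = mat n n (\<lambda>(i,j). if i = j then complex_of_real (l i) else 0)"
  have L: "L \<in> carrier_mat n n" by (simp add: L_def)
  have cU: "cadj U \<in> carrier_mat n n" using U by simp
  have UU: "U * cadj U = 1\<^sub>m n" by (rule mat_mult_left_right_inverse[OF cU U(1,2)])
  have norm_v: "(cnorm v)\<^sup>2 = (\<Sum>i<n. (cmod ((U *\<^sub>v v) $ i))\<^sup>2)" if v: "v \<in> carrier_vec n" for v
  proof -
    have Uv: "U *\<^sub>v v \<in> carrier_vec n" using U v by simp
    have "cadj U *\<^sub>v (U *\<^sub>v v) = v"
      using assoc_mult_mat_vec[OF cU U(1) v] U(2) v by simp
    hence "(U *\<^sub>v v) \<bullet>c (U *\<^sub>v v) = v \<bullet>c v" using cscalar_prod_cadj[OF U(1) v Uv] by simp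
    hence "(cnorm (U *\<^sub>v v))\<^sup>2 = (cnorm v)\<^sup>2" unfolding cscalar_prod_self of_real_eq_iff .
    thus ?thesis using Uv U by (simp add: cnorm_sq del: index_mult_mat_vec)
  qed
  have norm_Xv: "(cnorm (X *\<^sub>v v))\<^sup>2 = (\<Sum>i<n. l i * (cmod ((U *\<^sub>v v) $ i))\<^sup>2)"
    if v: "v \<in> carrier_vec n" for v
  proof -
    define y where "y = U *\<^sub>v v"
    have y: "y \<in> carrier_vec n" using U v by (simp add: y_def)
    have Ly: "L *\<^sub>v y \<in> carrier_vec n" using L y by simp
    have Ly_i: "(L *\<^sub>v y) $ i = of_real (l i) * y $ i" if "i < n" for i
      using that by (subst mult_mat_vec_index[OF L y that]) (simp add: L_def if_distrib if_distribR sum.delta cong: if_cong)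
    have Xv: "X *\<^sub>v v \<in> carrier_vec m" using X v by simp
    have "cadj X *\<^sub>v (X *\<^sub>v v) = ?G *\<^sub>v v" using assoc_mult_mat_vec[OF cX X v] by simp
    also have "\<dots> = cadj U *\<^sub>v (L *\<^sub>v y)"
      unfolding GL L_def[symmetric] y_def using cU L U v
        assoc_mult_mat_vec[OF mult_carrier_mat[OF cU L] U(1) v] assoc_mult_mat_vec[OF cU L, of "U *\<^sub>v v"] by simp
    finally have "(X *\<^sub>v v) \<bullet>c (X *\<^sub>v v) = v \<bullet>c (cadj U *\<^sub>v (L *\<^sub>v y))"
      using cscalar_prod_cadj[OF X v Xv] by simp
    also have "\<dots> = y \<bullet>c (L *\<^sub>v y)" using cscalar_prod_cadj[OF U(1) v Ly] by (simp add: y_def)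
    also have "\<dots> = (\<Sum>i<n. of_real (l i) * (y $ i * cnj (y $ i)))"
      unfolding cscalar_prod_sum[OF Ly] by (intro sum.cong) (auto simp: Ly_i simp del: index_mult_mat_vec)
    also have "\<dots> = of_real (\<Sum>i<n. l i * (cmod (y $ i))\<^sup>2)"
      by (simp add: complex_norm_square[symmetric])
    finally show ?thesis unfolding cscalar_prod_self of_real_eq_iff y_def .
  qed
  have ev: "\<exists>v\<in>carrier_vec n. cnorm v = 1 \<and> (cnorm (X *\<^sub>v v))\<^sup>2 = l i" if i: "i < n" for i
  proof -
    define v where "v = cadj U *\<^sub>v unit_vec n i"
    have v: "v \<in> carrier_vec n" using cU by (simp add: v_def)
    have "U *\<^sub>v v = unit_vec n i"
      unfolding v_def using assoc_mult_mat_vec[OF U(1) cU unit_vec_carrier] UU by simp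
    hence Uv: "(cmod ((U *\<^sub>v v) $ j))\<^sup>2 = (if j = i then 1 else 0)" if "j < n" for j
      using that i by (simp del: index_mult_mat_vec)
    have "(cnorm v)\<^sup>2 = 1" using i unfolding norm_v[OF v] by (simp add: Uv del: index_mult_mat_vec)
    hence "cnorm v = 1" using cnorm_nonneg[of v] by (simp add: power2_eq_1_iff)
    moreover have "(cnorm (X *\<^sub>v v))\<^sup>2 = l i"
      using i unfolding norm_Xv[OF v] by (simp add: Uv if_distrib sum.delta cong: if_cong del: index_mult_mat_vec)
    ultimately show ?thesis using v by blast
  qed
  \<comment> \<open>Here l still lists the eigenvalues of the Gram matrix. They are squared norms,
    so squaring their roots gives them back.\<close>
  have l0: "l i \<ge> 0" if "i < n" for i using ev[OF that] by (metis zero_le_power2)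
  have "col_sing_vals X = image_mset (\<lambda>i. sqrt (l i)) (mset_set {..<n})"
    unfolding col_sing_vals_def pr by (simp add: multiset.map_comp o_def)
  moreover have "\<forall>v\<in>carrier_vec n. (cnorm (X *\<^sub>v v))\<^sup>2 = (\<Sum>i<n. (sqrt (l i))\<^sup>2 * (cmod ((U *\<^sub>v v) $ i))\<^sup>2)"
    unfolding Ball_def by (intro allI impI, subst norm_Xv, assumption, intro sum.cong) (auto simp: l0)
  moreover have "\<forall>i<n. \<exists>v\<in>carrier_vec n. cnorm v = 1 \<and> cnorm (X *\<^sub>v v) = sqrt (l i)"
    using ev by (metis cnorm_nonneg real_sqrt_unique)
  ultimately show ?thesis using that[OF U(1)] norm_v by blast
qed

lemma size_col_sing_vals: "X \<in> carrier_mat m n \<Longrightarrow> size (col_sing_vals X) = n"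
  by (rule col_sing_vals_spectral[of X m n]) auto

lemma col_sing_vals_nonneg: "s \<in># col_sing_vals X \<Longrightarrow> 0 \<le> s"
  by (rule col_sing_vals_spectral[of X "dim_row X" "dim_col X"]) (auto, metis cnorm_nonneg)

text \<open>Forward, the weights in the expansion of the squared norm are at most w^2; backward, the
  bound is tested on the unit vectors attaining each singular value. Both directions are used: one
  to apply a bound on \<open>spec_norm\<close> to a vector, the other to bound
  \<open>spec_norm\<close> by entries.\<close>

lemma col_sing_vals_bound_iff:
  assumes X: "X \<in> carrier_mat m n" and "0 \<le> w"
  shows "(\<forall>s\<in>#col_sing_vals X. s \<le> w) \<longleftrightarrow> (\<forall>v\<in>carrier_vec n. cnorm (X *\<^sub>v v) \<le> w * cnorm v)"
proof -
  obtain U l where U: "U \<in> carrier_mat n n"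
    and sv: "col_sing_vals X = image_mset l (mset_set {..<n})"
    and nv': "\<forall>v\<in>carrier_vec n. (cnorm v)\<^sup>2 = (\<Sum>i<n. (cmod ((U *\<^sub>v v) $ i))\<^sup>2)"
    and nX': "\<forall>v\<in>carrier_vec n. (cnorm (X *\<^sub>v v))\<^sup>2 = (\<Sum>i<n. (l i)\<^sup>2 * (cmod ((U *\<^sub>v v) $ i))\<^sup>2)"
    and ev': "\<forall>i<n. \<exists>v\<in>carrier_vec n. cnorm v = 1 \<and> cnorm (X *\<^sub>v v) = l i"
    by (rule col_sing_vals_spectral[OF X])
  note nv = nv'[rule_format] and nX = nX'[rule_format] and ev = ev'[rule_format]
  show ?thesis
  proof
    assume le: "\<forall>s\<in>#col_sing_vals X. s \<le> w"
    show "\<forall>v\<in>carrier_vec n. cnorm (X *\<^sub>v v) \<le> w * cnorm v"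
    proof
      fix v :: "complex vec" assume v: "v \<in> carrier_vec n"
      have "(cnorm (X *\<^sub>v v))\<^sup>2 \<le> (\<Sum>i<n. w\<^sup>2 * (cmod ((U *\<^sub>v v) $ i))\<^sup>2)"
        unfolding nX[OF v]
      proof (intro sum_mono mult_right_mono power_mono)
        fix i assume "i \<in> {..<n}"
        thus "l i \<le> w" "0 \<le> l i" using le ev[of i] cnorm_nonneg by (auto simp: sv) (metis cnorm_nonneg)
      qed auto
      also have "\<dots> = (w * cnorm v)\<^sup>2"
        by (simp add: nv[OF v] power_mult_distrib sum_distrib_left del: index_mult_mat_vec)
      finally show "cnorm (X *\<^sub>v v) \<le> w * cnorm v"
        by (rule power2_le_imp_le) (simp add: \<open>0 \<le> w\<close>)
    qed
  next
    assume "\<forall>v\<in>carrier_vec n. cnorm (X *\<^sub>v v) \<le> w * cnorm v"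
    thus "\<forall>s\<in>#col_sing_vals X. s \<le> w" using ev by (force simp: sv)
  qed
qed

text \<open>The product has no conjugation, so for a row of \<open>U\<close> it is the corresponding
  coordinate of U v. Conditions from several matrices can then be joined into one list.\<close>

lemma common_orthogonal_vector:
  fixes rs :: "'a :: field vec list"
  assumes "set rs \<subseteq> carrier_vec n" "length rs < n"
  obtains v where "v \<in> carrier_vec n" "v \<noteq> 0\<^sub>v n" "\<And>r. r \<in> set rs \<Longrightarrow> r \<bullet> v = 0"
proof -
  have M: "mat_of_rows n rs \<in> carrier_mat (length rs) n" by simp
  obtain v where v: "v \<in> carrier_vec n" "v \<noteq> 0\<^sub>v n" "mat_of_rows n rs *\<^sub>v v = 0\<^sub>v (length rs)"
    by (rule homogeneous_system_nontrivial[OF M assms(2)])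
  have "r \<bullet> v = 0" if r: "r \<in> set rs" for r
  proof -
    obtain i where i: "i < length rs" "rs ! i = r" using r by (auto simp: in_set_conv_nth)
    have "(mat_of_rows n rs *\<^sub>v v) $ i = r \<bullet> v" using i assms(1) r by (auto simp: mat_of_rows_row)
    thus ?thesis using v i by simp
  qed
  thus ?thesis using that v by blast
qed

lemma size_filter_image_mset_set:
  "finite I \<Longrightarrow> size {#s \<in># image_mset l (mset_set I). P s#} = card {i\<in>I. P (l i)}"
  by (simp add: filter_mset_image_mset)

text \<open>Courant--Fischer in disguise: if the count of \<open>A = B + C * Q + N\<close> were larger, some nonzero \<open>v\<close> would be
  orthogonal to the small right singular vectors of \<open>A\<close>, to the large ones of \<open>B\<close>, and to
  the rows of \<open>Q\<close>.\<close>

lemma col_sing_vals_count: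
  assumes B: "B \<in> carrier_mat m n" and C: "C \<in> carrier_mat m k" and Q: "Q \<in> carrier_mat k n"
    and N: "N \<in> carrier_mat m n"
    and w: "0 \<le> w" "\<forall>s\<in>#col_sing_vals N. s \<le> w"
  shows "size {#s \<in># col_sing_vals (B + C * Q + N). s > x + w#} \<le> size {#s \<in># col_sing_vals B. s > x#} + k"
proof (cases "0 \<le> x")
  \<comment> \<open>Below level 0 all n values of B are counted and the claim is trivial. The other
    case needs the levels nonnegative in order to compare squares.\<close>
  case False
  have "size {#s \<in># col_sing_vals (B + C * Q + N). s > x + w#} \<le> n"
    using size_col_sing_vals[of "B + C * Q + N" m n] N
    by (metis add_carrier_mat size_filter_mset_lesseq)
  also have "n = size {#s \<in># col_sing_vals B. s > x#}"
    using False col_sing_vals_nonneg[of _ B] size_col_sing_vals[OF B]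
    by (subst filter_mset_cong[OF refl, of _ _ "\<lambda>_. True"]) force+
  finally show ?thesis by simp
next
  case True
  define A where "A = B + C * Q + N"
  have A: "A \<in> carrier_mat m n" using N by (simp add: A_def)
  obtain UA a where UA: "UA \<in> carrier_mat n n"
    and svA: "col_sing_vals A = image_mset a (mset_set {..<n})"
    and nA': "\<forall>v\<in>carrier_vec n. (cnorm v)\<^sup>2 = (\<Sum>i<n. (cmod ((UA *\<^sub>v v) $ i))\<^sup>2)"
    and AA': "\<forall>v\<in>carrier_vec n. (cnorm (A *\<^sub>v v))\<^sup>2 = (\<Sum>i<n. (a i)\<^sup>2 * (cmod ((UA *\<^sub>v v) $ i))\<^sup>2)"
    by (rule col_sing_vals_spectral[OF A])
  note nA = nA'[rule_format] and AA = AA'[rule_format]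
  obtain UB b where UB: "UB \<in> carrier_mat n n"
    and svB: "col_sing_vals B = image_mset b (mset_set {..<n})"
    and nB': "\<forall>v\<in>carrier_vec n. (cnorm v)\<^sup>2 = (\<Sum>i<n. (cmod ((UB *\<^sub>v v) $ i))\<^sup>2)"
    and BB': "\<forall>v\<in>carrier_vec n. (cnorm (B *\<^sub>v v))\<^sup>2 = (\<Sum>i<n. (b i)\<^sup>2 * (cmod ((UB *\<^sub>v v) $ i))\<^sup>2)"
    and B1': "\<forall>i<n. \<exists>v\<in>carrier_vec n. cnorm v = 1 \<and> cnorm (B *\<^sub>v v) = b i"
    by (rule col_sing_vals_spectral[OF B])
  note nB = nB'[rule_format] and BB = BB'[rule_format] and B1 = B1'[rule_format]
  have b0: "0 \<le> b i" if "i < n" for i using B1[OF that] by (metis cnorm_nonneg)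
  define IA where "IA = {i\<in>{..<n}. \<not> a i > x + w}"
  define IB where "IB = {i\<in>{..<n}. b i > x}"
  have "card {i\<in>{..<n}. a i > x + w} \<le> card IB + k"
  proof (rule ccontr)
    assume "\<not> ?thesis"
    moreover have "card IA + card {i\<in>{..<n}. a i > x + w} = n"
      unfolding IA_def by (subst card_Un_disjoint[symmetric]) (auto intro!: arg_cong[of _ "{..<n}" card, simplified])
    ultimately have less: "card IA + card IB + k < n" by linarith
    have fin: "finite IA" "finite IB" by (auto simp: IA_def IB_def)
    define rs where "rs = map (row UA) (sorted_list_of_set IA) @ map (row UB) (sorted_list_of_set IB) @ rows Q"
    have rs: "set rs \<subseteq> carrier_vec n" "length rs < n"
      using UA UB Q less fin by (auto simp: rs_def rows_def)
    obtain v where v: "v \<in> carrier_vec n" "v \<noteq> 0\<^sub>v n" "\<And>r. r \<in> set rs \<Longrightarrow> r \<bullet> v = 0"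
      using common_orthogonal_vector[OF rs] by metis
    have vA: "(UA *\<^sub>v v) $ i = 0" if "i \<in> IA" for i
      using that v(3)[of "row UA i"] fin UA by (auto simp: rs_def IA_def)
    have vB: "(UB *\<^sub>v v) $ i = 0" if "i \<in> IB" for i
      using that v(3)[of "row UB i"] fin UB by (auto simp: rs_def IB_def)
    have "Q *\<^sub>v v = 0\<^sub>v k"
      using v(3) Q by (intro eq_vecI) (auto simp: rs_def rows_def)
    moreover have "C *\<^sub>v 0\<^sub>v k = 0\<^sub>v m" using C by (intro eq_vecI) auto
    ultimately have CQv: "(C * Q) *\<^sub>v v = 0\<^sub>v m" using assoc_mult_mat_vec[OF C Q v(1)] by simp
    have v0: "0 < cnorm v" using v cnorm_eq_0_iff[OF v(1)] cnorm_nonneg[of v] by linarith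
    have Bv: "cnorm (B *\<^sub>v v) \<le> x * cnorm v"
    proof (rule power2_le_imp_le)
      have "(cnorm (B *\<^sub>v v))\<^sup>2 \<le> (\<Sum>i<n. x\<^sup>2 * (cmod ((UB *\<^sub>v v) $ i))\<^sup>2)"
        unfolding BB[OF v(1)]
      proof (rule sum_mono)
        fix i assume i: "i \<in> {..<n}"
        show "(b i)\<^sup>2 * (cmod ((UB *\<^sub>v v) $ i))\<^sup>2 \<le> x\<^sup>2 * (cmod ((UB *\<^sub>v v) $ i))\<^sup>2"
        proof (cases "i \<in> IB")
          case False
          hence "(b i)\<^sup>2 \<le> x\<^sup>2" using i b0 by (intro power_mono) (auto simp: IB_def)
          thus ?thesis by (rule mult_right_mono) simp
        qed (use vB in simp)
      qed
      thus "(cnorm (B *\<^sub>v v))\<^sup>2 \<le> (x * cnorm v)\<^sup>2"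
        by (simp add: nB[OF v(1)] power_mult_distrib sum_distrib_left del: index_mult_mat_vec)
    qed (use True in simp)
    have Av: "(x + w) * cnorm v < cnorm (A *\<^sub>v v)"
    proof (rule power2_less_imp_less)
      \<comment> \<open>A nonzero v has a nonzero coordinate, and it lies outside \<open>IA\<close>,
        where coordinates vanish. That single term makes the inequality strict.\<close>
      obtain j where j: "j < n" "(UA *\<^sub>v v) $ j \<noteq> 0"
      proof (rule ccontr)
        assume "\<not> thesis"
        hence "\<forall>j<n. (UA *\<^sub>v v) $ j = 0" using that by blast
        hence "(cnorm v)\<^sup>2 = 0" unfolding nA[OF v(1)] by (simp del: index_mult_mat_vec)
        thus False using v0 by simp
      qed
      have "((x + w) * cnorm v)\<^sup>2 = (\<Sum>i<n. (x + w)\<^sup>2 * (cmod ((UA *\<^sub>v v) $ i))\<^sup>2)"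
        by (simp add: nA[OF v(1)] power_mult_distrib sum_distrib_left del: index_mult_mat_vec)
      also have "\<dots> < (\<Sum>i<n. (a i)\<^sup>2 * (cmod ((UA *\<^sub>v v) $ i))\<^sup>2)"
      proof (rule sum_strict_mono_ex1)
        have sq: "(x + w)\<^sup>2 < (a i)\<^sup>2" if "i < n" "i \<notin> IA" for i
          using that True w by (intro power_strict_mono) (auto simp: IA_def)
        show "\<forall>i\<in>{..<n}. (x + w)\<^sup>2 * (cmod ((UA *\<^sub>v v) $ i))\<^sup>2 \<le> (a i)\<^sup>2 * (cmod ((UA *\<^sub>v v) $ i))\<^sup>2"
        proof
          fix i assume i: "i \<in> {..<n}"
          show "(x + w)\<^sup>2 * (cmod ((UA *\<^sub>v v) $ i))\<^sup>2 \<le> (a i)\<^sup>2 * (cmod ((UA *\<^sub>v v) $ i))\<^sup>2"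
            using vA[of i] sq[of i] i by (cases "i \<in> IA") (auto intro!: mult_right_mono simp del: index_mult_mat_vec)
        qed
        show "\<exists>i\<in>{..<n}. (x + w)\<^sup>2 * (cmod ((UA *\<^sub>v v) $ i))\<^sup>2 < (a i)\<^sup>2 * (cmod ((UA *\<^sub>v v) $ i))\<^sup>2"
          using j vA[of j] sq[of j] by (intro bexI[of _ j]) (auto simp del: index_mult_mat_vec)
      qed simp
      finally show "((x + w) * cnorm v)\<^sup>2 < (cnorm (A *\<^sub>v v))\<^sup>2" unfolding AA[OF v(1)] .
    qed simp
    have "A *\<^sub>v v = B *\<^sub>v v + N *\<^sub>v v"
      unfolding A_def using B C Q N v(1) CQv by (simp add: add_mult_distrib_mat_vec[of _ m n])
    hence "cnorm (A *\<^sub>v v) \<le> cnorm (B *\<^sub>v v) + cnorm (N *\<^sub>v v)"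
      using cnorm_triangle[of "B *\<^sub>v v" m "N *\<^sub>v v"] B N v(1) by simp
    moreover have "cnorm (N *\<^sub>v v) \<le> w * cnorm v"
      using col_sing_vals_bound_iff[OF N w(1)] w(2) v(1) by blast
    ultimately show False using Av Bv by (simp add: distrib_right)
  qed
  thus ?thesis unfolding A_def[symmetric] svA svB
    by (simp only: size_filter_image_mset_set[OF finite_lessThan] IB_def)
qed

text \<open>The columns of C are a maximal independent set of columns of R, and Q holds the
  coordinates of all columns in it. Maximality puts every column into the span.\<close>

lemma rank_factorization:
  fixes R :: "'a :: field mat"
  assumes R: "R \<in> carrier_mat m n"
  obtains C Q where "C \<in> carrier_mat m (vec_space.rank m R)" "Q \<in> carrier_mat (vec_space.rank m R) n"
    "R = C * Q"
proof -
  interpret vec_space "TYPE('a)" m .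
  obtain S where S: "maximal S (\<lambda>T. T \<subseteq> set (cols R) \<and> lin_indpt T)" "finite S"
    using maximal_exists_superset[of "set (cols R)" "\<lambda>T. T \<subseteq> set (cols R) \<and> lin_indpt T" "{}"]
    by (auto simp: lin_dep_def)
  have rk: "rank R = card S" by (rule rank_card_indpt[OF R S(1)])
  have SR: "S \<subseteq> set (cols R)" "lin_indpt S" using S(1) by (auto simp: maximal_def)
  have Rm: "set (cols R) \<subseteq> carrier_vec m" using R cols_dim by blast
  have Sm: "S \<subseteq> carrier_vec m" using SR Rm by blast
  have "\<exists>a. col R j = lincomb a S" if j: "j < n" for j
  proof -
    have cj: "col R j \<in> set (cols R)" using R j by (auto simp: cols_def)
    have "col R j \<in> span S"
    proof (rule ccontr)
      assume nin: "col R j \<notin> span S"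
      hence "col R j \<notin> S" using Sm span_mem by auto
      moreover have "lin_indpt (insert (col R j) S)"
        using lin_dep_iff_in_span[OF Sm SR(2), of "col R j"] nin \<open>col R j \<notin> S\<close> cj Rm by auto
      ultimately show False using S(1) SR cj unfolding maximal_def by blast
    qed
    thus ?thesis using finite_in_span[OF S(2) Sm] by metis
  qed
  then obtain a where a: "\<And>j. j < n \<Longrightarrow> col R j = lincomb (a j) S" by metis
  obtain bs where bs: "set bs = S" "distinct bs" using finite_distinct_list[OF S(2)] by auto
  have len: "length bs = rank R" using bs rk by (metis distinct_card)
  define C where "C = mat m (rank R) (\<lambda>(i,k). (bs ! k) $ i)"
  define Q where "Q = mat (rank R) n (\<lambda>(k,j). a j (bs ! k))"
  have C: "C \<in> carrier_mat m (rank R)" and Q: "Q \<in> carrier_mat (rank R) n"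
    unfolding C_def Q_def by auto
  have "R = C * Q"
  proof (rule eq_matI)
    fix i j assume "i < dim_row (C * Q)" "j < dim_col (C * Q)"
    hence ij: "i < m" "j < n" using C Q by auto
    have "R $$ (i,j) = lincomb (a j) S $ i" using a[OF ij(2)] R ij by (metis carrier_matD index_col)
    also have "\<dots> = (\<Sum>x\<in>S. a j x * x $ i)" by (rule lincomb_index[OF ij(1) Sm])
    also have "\<dots> = (\<Sum>k<rank R. a j (bs ! k) * (bs ! k) $ i)"
      using bs len by (intro sum.reindex_bij_betw[symmetric]) (metis bij_betw_nth)
    also have "\<dots> = (C * Q) $$ (i,j)"
      unfolding mult_mat_index[OF C Q ij] using ij by (auto simp: C_def Q_def mult.commute)
    finally show "R $$ (i,j) = (C * Q) $$ (i,j)" .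
  qed (use R C Q in auto)
  thus ?thesis using that C Q by blast
qed

section \<open>Two-sided comparison of singular value counts\<close>

lemma size_sing_vals: "X \<in> carrier_mat m n \<Longrightarrow> size (sing_vals X) = min m n"
  using size_col_sing_vals[of X m n] size_col_sing_vals[of "cadj X" n m]
  by (auto simp: sing_vals_eq_col_sing_vals)

lemma sing_vals_nonneg: "s \<in># sing_vals X \<Longrightarrow> 0 \<le> s"
  by (auto simp: sing_vals_eq_col_sing_vals intro: col_sing_vals_nonneg)

lemma spec_norm_nonneg: "0 \<le> spec_norm X"
  unfolding spec_norm_def by (intro Max_ge) auto

lemma sing_vals_le_spec_norm: "s \<in># sing_vals X \<Longrightarrow> s \<le> spec_norm X"
  unfolding spec_norm_def by (intro Max_ge) auto

lemma sing_vals_uminus: "X \<in> carrier_mat m n \<Longrightarrow> sing_vals (- X) = sing_vals X"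
proof -
  assume X: "X \<in> carrier_mat m n"
  have "cadj (- X) = - cadj X" by (intro eq_matI) (auto simp: cadj_def)
  thus ?thesis using X by (simp add: sing_vals_def)
qed

text \<open>For m \<le> n the singular values are read off the adjoints. Taking adjoints turns C Q
  into a product that again factors through dimension k, and the bound on N refers to the adjoint in
  the same case.\<close>

lemma sing_vals_count:
  assumes B: "B \<in> carrier_mat m n" and C: "C \<in> carrier_mat m k" and Q: "Q \<in> carrier_mat k n"
    and N: "N \<in> carrier_mat m n" and w: "spec_norm N \<le> w"
  shows "size {#s \<in># sing_vals (B + C * Q + N). s > x + w#} \<le> size {#s \<in># sing_vals B. s > x#} + k"
proof -
  have w0: "0 \<le> w" using w spec_norm_nonneg[of N] by linarith
  have wN: "\<forall>s\<in>#sing_vals N. s \<le> w" using w sing_vals_le_spec_norm[of _ N] by force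
  show ?thesis
  proof (cases "m \<le> n")
    case False
    thus ?thesis using col_sing_vals_count[OF B C Q N w0] wN B N C Q
      by (simp add: sing_vals_eq_col_sing_vals)
  next
    case True
    have "cadj (B + C * Q + N) = cadj B + cadj Q * cadj C + cadj N"
      using cadj_add[OF add_carrier_mat[OF mult_carrier_mat[OF C Q], of B] N]
        cadj_add[OF B mult_carrier_mat[OF C Q]] cadj_mult[OF C Q] by (simp only:)
    thus ?thesis using col_sing_vals_count[of "cadj B" n m "cadj Q" k "cadj C" "cadj N" w x] True w0 wN B C Q N
      by (simp add: sing_vals_eq_col_sing_vals)
  qed
qed

lemma sing_vals_count_perturbation:
  assumes B: "B \<in> carrier_mat m n" and R: "R \<in> carrier_mat m n" and N: "N \<in> carrier_mat m n"
    and A: "A = B + R + N" and w: "spec_norm N \<le> w"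
  shows "size {#s \<in># sing_vals A. s > x + w#} \<le> size {#s \<in># sing_vals B. s > x#} + mrank R"
    and "size {#s \<in># sing_vals B. s > x + w#} \<le> size {#s \<in># sing_vals A. s > x#} + mrank R"
proof -
  have rk: "mrank R = vec_space.rank m R" using R by (simp add: mrank_def)
  obtain C Q where C: "C \<in> carrier_mat m (mrank R)" and Q: "Q \<in> carrier_mat (mrank R) n"
    and CQ: "R = C * Q" unfolding rk by (rule rank_factorization[OF R])
  show "size {#s \<in># sing_vals A. s > x + w#} \<le> size {#s \<in># sing_vals B. s > x#} + mrank R"
    unfolding A CQ using sing_vals_count[OF B C Q N w] CQ by simp
  \<comment> \<open>The reverse inequality is the first one for B = A - R - N. Negating only C keeps
    the inner dimension, so \<open>mrank R\<close> appears again.\<close>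
  have mC: "- C \<in> carrier_mat m (mrank R)" and mN: "- N \<in> carrier_mat m n" using C N by auto
  have Ac: "A \<in> carrier_mat m n" using B R N A by simp
  have "- C * Q = - R" using C Q CQ by simp
  hence "B = A + - C * Q + - N"
    using B R N unfolding A by (intro eq_matI) auto
  moreover have "spec_norm (- N) \<le> w" using w by (simp add: spec_norm_def sing_vals_uminus[OF N])
  ultimately show "size {#s \<in># sing_vals B. s > x + w#} \<le> size {#s \<in># sing_vals A. s > x#} + mrank R"
    using sing_vals_count[OF Ac mC Q mN] by metis
qed

section \<open>Bounding the spectral norm by the entries\<close>

lemma cnorm_mult_mat_vec_le_entries:
  assumes X: "X \<in> carrier_mat m n" and v: "v \<in> carrier_vec n"
  shows "cnorm (X *\<^sub>v v) \<le> (\<Sum>i<m. \<Sum>j<n. cmod (X $$ (i,j))) * cnorm v"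
proof -
  have vj: "cmod (v $ j) \<le> cnorm v" if "j < n" for j
    unfolding cnorm_def using that v by (intro member_le_L2_set) auto
  have "cnorm (X *\<^sub>v v) \<le> (\<Sum>i<m. cmod ((X *\<^sub>v v) $ i))"
    unfolding cnorm_def using X by (simp add: L2_set_le_sum del: index_mult_mat_vec)
  also have "\<dots> \<le> (\<Sum>i<m. \<Sum>j<n. cmod (X $$ (i,j)) * cnorm v)"
  proof (rule sum_mono)
    fix i assume "i \<in> {..<m}"
    hence "(X *\<^sub>v v) $ i = (\<Sum>j<n. X $$ (i,j) * v $ j)" using mult_mat_vec_index[OF X v] by simp
    also have "cmod \<dots> \<le> (\<Sum>j<n. cmod (X $$ (i,j)) * cnorm v)"
      by (intro sum_norm_le) (auto simp: norm_mult intro!: mult_left_mono vj)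
    finally show "cmod ((X *\<^sub>v v) $ i) \<le> (\<Sum>j<n. cmod (X $$ (i,j)) * cnorm v)" .
  qed
  finally show ?thesis by (simp add: sum_distrib_right)
qed

lemma spec_norm_le_entries:
  assumes X: "X \<in> carrier_mat m n"
  shows "spec_norm X \<le> (\<Sum>i<m. \<Sum>j<n. cmod (X $$ (i,j)))"
proof -
  let ?w = "\<Sum>i<m. \<Sum>j<n. cmod (X $$ (i,j))"
  have w0: "0 \<le> ?w" by (intro sum_nonneg) auto
  have 1: "\<forall>s\<in>#col_sing_vals X. s \<le> ?w"
    using col_sing_vals_bound_iff[OF X w0] cnorm_mult_mat_vec_le_entries[OF X] by blast
  \<comment> \<open>The entry sum is invariant under the adjoint, so the bound holds whichever Gram
    matrix \<open>sing_vals\<close> uses.\<close>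
  have "(\<Sum>i<n. \<Sum>j<m. cmod (cadj X $$ (i,j))) = ?w"
    by (subst sum.swap) (simp add: cadj_index[OF X])
  hence "\<forall>s\<in>#col_sing_vals (cadj X). s \<le> ?w"
    using col_sing_vals_bound_iff[OF cadj_carrier[OF X] w0] cnorm_mult_mat_vec_le_entries[OF cadj_carrier[OF X]]
    by simp
  with 1 w0 show ?thesis unfolding spec_norm_def by (auto simp: sing_vals_eq_col_sing_vals)
qed

section \<open>Sums of test functions over multisets\<close>

text \<open>Put x = \<open>ys ! (j + r)\<close>, and let n be the common length. If the claim
  failed, the n - j entries of \<open>xs\<close> from j on would exceed x + w, while at most n - j -
  r - 1 entries of \<open>ys\<close> exceed x; adding r does not make up for it.\<close>

lemma sorted_shift_le:
  fixes xs ys :: "real list"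
  assumes "sorted xs" "sorted ys" "length xs = length ys"
    and cnt: "\<And>x. length (filter (\<lambda>s. s > x + w) xs) \<le> length (filter (\<lambda>s. s > x) ys) + r"
    and j: "j + r < length ys"
  shows "xs ! j \<le> ys ! (j + r) + w"
proof (rule ccontr)
  assume *: "\<not> ?thesis"
  define x where "x = ys ! (j + r)"
  have "length xs - j = card {j..<length xs}" by simp
  also have "\<dots> \<le> card {i. i < length xs \<and> xs ! i > x + w}"
    using * sorted_nth_mono[OF assms(1)] by (intro card_mono) (force simp: x_def)+
  also have "\<dots> \<le> card {i. i < length ys \<and> ys ! i > x} + r"
    using cnt[of x] by (simp add: length_filter_conv_card)
  also have "card {i. i < length ys \<and> ys ! i > x} \<le> card {j + r<..<length ys}"
  proof (intro card_mono subsetI)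
    fix i assume i: "i \<in> {i. i < length ys \<and> ys ! i > x}"
    have "\<not> i \<le> j + r" using i sorted_nth_mono[OF assms(2), of i "j + r"] j by (auto simp: x_def)
    thus "i \<in> {j + r<..<length ys}" using i by auto
  qed simp
  finally show False using assms(3) j by simp
qed

lemma sum_mset_mset_nth: "(\<Sum>s\<in>#mset xs. G s) = (\<Sum>j<length xs. G (xs ! j))"
proof -
  have "(\<Sum>s\<in>#mset xs. G s) = sum_list (map G xs)" by (metis mset_map sum_mset_sum_list)
  thus ?thesis by (simp add: sum_list_sum_nth atLeast0LessThan)
qed

lemma sum_mset_mono_shift_le:
  fixes S T :: "real multiset" and G :: "real \<Rightarrow> real"
  assumes size: "size S = n" "size T = n"
    and cnt: "\<And>x. size {#s \<in># S. s > x + w#} \<le> size {#s \<in># T. s > x#} + r"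
    and G: "mono G" "\<And>x. 0 \<le> G x" "\<And>x. G x \<le> 1" "\<And>x. G (x + w) \<le> G x + L"
    and "0 \<le> L"
  shows "(\<Sum>s\<in>#S. G s) \<le> (\<Sum>s\<in>#T. G s) + real r + real n * L"
proof -
  define xs where "xs = sorted_list_of_multiset S"
  define ys where "ys = sorted_list_of_multiset T"
  have ms: "mset xs = S" "mset ys = T" by (auto simp: xs_def ys_def)
  have len: "length xs = n" "length ys = n" using ms size by (metis size_mset)+
  have sorted: "sorted xs" "sorted ys" by (auto simp: xs_def ys_def sorted_sorted_list_of_multiset)
  have cnt': "length (filter (\<lambda>s. s > x + w) xs) \<le> length (filter (\<lambda>s. s > x) ys) + r" for x
    using cnt[of x] unfolding ms[symmetric] by (metis mset_filter size_mset)
  have le: "G (xs ! j) \<le> G (ys ! (j + r)) + L" if "j < n - r" for j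
  proof -
    have "G (xs ! j) \<le> G (ys ! (j + r) + w)"
      using sorted_shift_le[OF sorted _ cnt', of j] that len by (intro monoD[OF G(1)]) auto
    thus ?thesis using G(4)[of "ys ! (j + r)"] by linarith
  qed
  have "(\<Sum>s\<in>#S. G s) = (\<Sum>j<n. G (xs ! j))"
    using len sum_mset_mset_nth[of G xs] by (simp add: ms)
  also have "\<dots> \<le> (\<Sum>j<n - r. G (xs ! j)) + real r"
  proof -
    have "(\<Sum>j<n. G (xs ! j)) = (\<Sum>j<n - r. G (xs ! j)) + (\<Sum>j=n - r..<n. G (xs ! j))"
      using sum.atLeastLessThan_concat[of 0 "n - r" n "\<lambda>j. G (xs ! j)"] by (simp add: atLeast0LessThan)
    moreover have "(\<Sum>j=n - r..<n. G (xs ! j)) \<le> (\<Sum>j=n - r..<n. 1)" by (intro sum_mono G)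
    ultimately show ?thesis by simp
  qed
  also have "(\<Sum>j<n - r. G (xs ! j)) \<le> (\<Sum>j<n - r. G (ys ! (j + r)) + L)"
    by (intro sum_mono) (auto intro: le)
  also have "\<dots> = (\<Sum>j<n - r. G (ys ! (j + r))) + real (n - r) * L" by (simp add: sum.distrib)
  also have "(\<Sum>j<n - r. G (ys ! (j + r))) = (\<Sum>j\<in>(\<lambda>j. j + r) ` {..<n - r}. G (ys ! j))"
    by (subst sum.reindex) auto
  also have "\<dots> \<le> (\<Sum>j<n. G (ys ! j))"
    by (intro sum_mono2) (auto intro: G)
  also have "\<dots> = (\<Sum>s\<in>#T. G s)"
    using len sum_mset_mset_nth[of G ys] by (simp add: ms)
  also have "real (n - r) * L \<le> real n * L" using \<open>0 \<le> L\<close> by (intro mult_right_mono) auto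
  finally show ?thesis by linarith
qed

section \<open>Approximation of test functions by ramps\<close>

definition ramp :: "real \<Rightarrow> real" where "ramp x = max 0 (min 1 x)"

lemma ramp_bounds: "0 \<le> ramp x" "ramp x \<le> 1"
  by (auto simp: ramp_def)

lemma ramp_mono: "x \<le> y \<Longrightarrow> ramp x \<le> ramp y"
  by (auto simp: ramp_def)

text \<open>The approximant is the piecewise linear interpolation of \<open>F\<close> on the grid \<open>\<delta> \<nat>\<close>. Ramps rather
  than hat functions are used because counting functions only control sums of monotone functions.\<close>

lemma Cc_ramp_approximation:
  assumes F: "F \<in> Cc" and "0 < \<epsilon>"
  obtains \<delta> m c where "0 < \<delta>"
    "\<forall>x\<ge>0. cmod (F x - (F 0 + (\<Sum>i<m. c i * complex_of_real (ramp (x / \<delta> - real i))))) \<le> \<epsilon>"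
proof -
  have cont: "continuous_on UNIV F" and cpt: "compact (closure {x. F x \<noteq> 0})"
    using F by (auto simp: Cc_def)
  obtain b where b: "\<And>x. F x \<noteq> 0 \<Longrightarrow> \<bar>x\<bar> \<le> b"
  proof -
    obtain b where "\<forall>x\<in>closure {x. F x \<noteq> 0}. \<bar>x\<bar> \<le> b"
      using compact_imp_bounded[OF cpt] unfolding bounded_iff by auto
    thus ?thesis using closure_subset[of "{x. F x \<noteq> 0}"] by (intro that[of b]) blast
  qed
  \<comment> \<open>Adding 1 makes b' positive and puts it outside the support, so F vanishes at b'
    itself.\<close>
  define b' where "b' = max b 0 + 1"
  have b': "F x = 0" if "x \<ge> b'" for x using b[of x] that by (force simp: b'_def)
  have "uniformly_continuous_on {0..b'} F"
    by (intro compact_uniformly_continuous continuous_on_subset[OF cont]) auto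
  then obtain d where d: "0 < d" "\<And>x y. x \<in> {0..b'} \<Longrightarrow> y \<in> {0..b'} \<Longrightarrow> \<bar>x - y\<bar> < d \<Longrightarrow> cmod (F x - F y) < \<epsilon> / 2"
    using \<open>0 < \<epsilon>\<close> unfolding uniformly_continuous_on_def dist_norm real_norm_def
    by (metis half_gt_zero)
  obtain m :: nat where m: "b' / d < real m" using reals_Archimedean2 by blast
  have b'0: "0 < b'" by (simp add: b'_def)
  have m0: "0 < m" using m b'0 d(1) by (metis divide_pos_pos gr0I less_trans not_less_iff_gr_or_eq of_nat_0)
  \<comment> \<open>The mesh divides b', so the telescoping sum over all m cells ends exactly at F
    b' = 0.\<close>
  define \<delta> where "\<delta> = b' / real m"
  have \<delta>: "0 < \<delta>" "\<delta> < d" "real m * \<delta> = b'"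
    using b'0 m0 m d(1) by (auto simp: \<delta>_def field_simps)
  define c where "c i = F (real (Suc i) * \<delta>) - F (real i * \<delta>)" for i
  have tele: "F 0 + (\<Sum>i<k. c i) = F (real k * \<delta>)" for k
    unfolding c_def by (subst sum_lessThan_telescope) simp
  have "cmod (F x - (F 0 + (\<Sum>i<m. c i * complex_of_real (ramp (x / \<delta> - real i))))) \<le> \<epsilon>"
    if x: "0 \<le> x" for x
  proof (cases "x < b'")
    case False
    have "(\<Sum>i<m. c i * complex_of_real (ramp (x / \<delta> - real i))) = (\<Sum>i<m. c i)"
    proof (rule sum.cong)
      fix i assume "i \<in> {..<m}"
      hence "(real i + 1) * \<delta> \<le> real m * \<delta>" using \<delta>(1) by (intro mult_right_mono) auto
      hence "real i + 1 \<le> x / \<delta>" using \<delta> False by (simp add: field_simps)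
      thus "c i * complex_of_real (ramp (x / \<delta> - real i)) = c i" by (simp add: ramp_def)
    qed simp
    thus ?thesis using tele[of m] \<delta>(3) b'[of b'] b'[of x] False \<open>0 < \<epsilon>\<close> by simp
  next
    case True
    define k where "k = nat \<lfloor>x / \<delta>\<rfloor>"
    have kx: "real k \<le> x / \<delta>" "x / \<delta> < real k + 1"
      using x \<delta>(1) by (auto simp: k_def of_nat_nat)
    have "x / \<delta> < real m" using True \<delta> by (simp add: field_simps)
    hence km: "k < m" using kx by linarith
    \<comment> \<open>For x in cell k the earlier ramps are saturated and the later ones vanish. The
      sum telescopes to the value of F at the left grid point plus one fraction of c k.\<close>
    have ramp: "ramp (x / \<delta> - real i) = (if i < k then 1 else if i = k then x / \<delta> - real k else 0)" for i
    proof -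
      have "real i + 1 \<le> real k" if "i < k" using that by linarith
      moreover have "real k + 1 \<le> real i" if "\<not> i < k" "i \<noteq> k" using that by linarith
      ultimately show ?thesis using kx by (auto simp: ramp_def)
    qed
    have "(\<Sum>i<m. c i * complex_of_real (ramp (x / \<delta> - real i)))
        = (\<Sum>i<Suc k. c i * complex_of_real (ramp (x / \<delta> - real i)))"
      using km by (intro sum.mono_neutral_right) (auto simp: ramp)
    also have "\<dots> = (\<Sum>i<k. c i) + c k * complex_of_real (x / \<delta> - real k)"
      by (simp add: ramp)
    finally have "F x - (F 0 + (\<Sum>i<m. c i * complex_of_real (ramp (x / \<delta> - real i))))
        = (F x - F (real k * \<delta>)) - c k * complex_of_real (x / \<delta> - real k)"
      using tele[of k] by (simp add: algebra_simps)
    also have "cmod \<dots> \<le> cmod (F x - F (real k * \<delta>)) + cmod (c k * complex_of_real (x / \<delta> - real k))"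
      by (rule norm_triangle_ineq4)
    also have "\<dots> \<le> \<epsilon> / 2 + \<epsilon> / 2"
    proof (rule add_mono)
      have kb: "real (Suc k) * \<delta> \<le> real m * \<delta>" using km \<delta>(1) by (intro mult_right_mono) auto
      hence in_b: "real k * \<delta> \<in> {0..b'}" "real (Suc k) * \<delta> \<in> {0..b'}"
        using \<delta> by (auto simp: distrib_right)
      have "\<bar>x - real k * \<delta>\<bar> < d" using kx \<delta> by (auto simp: field_simps abs_if)
      thus "cmod (F x - F (real k * \<delta>)) \<le> \<epsilon> / 2"
        using d(2)[of x "real k * \<delta>"] in_b x True by auto
      have "\<bar>real (Suc k) * \<delta> - real k * \<delta>\<bar> < d" using \<delta> by (simp add: algebra_simps)
      hence "cmod (c k) \<le> \<epsilon> / 2" unfolding c_def using d(2)[OF in_b(2) in_b(1)] by linarith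
      moreover have "cmod (complex_of_real (x / \<delta> - real k)) \<le> 1" unfolding norm_of_real using kx by linarith
      ultimately show "cmod (c k * complex_of_real (x / \<delta> - real k)) \<le> \<epsilon> / 2"
        unfolding norm_mult using mult_mono[of "cmod (c k)" "\<epsilon> / 2" "cmod (complex_of_real (x / \<delta> - real k))" 1] \<open>0 < \<epsilon>\<close> by simp
    qed
    finally show ?thesis by simp
  qed
  thus ?thesis using that \<delta>(1) by blast
qed

text \<open>The point is uniformity: K is chosen before the multisets, their size and the
  perturbation, so it can later be multiplied by quantities tending to 0.\<close>

lemma Cc_sum_mset_stability:
  assumes F: "F \<in> Cc" and "0 < \<epsilon>"
  obtains K where "0 \<le> K"
    "\<And>S T n w r. size S = n \<Longrightarrow> size T = n \<Longrightarrow> (\<And>s. s \<in># S \<Longrightarrow> 0 \<le> s) \<Longrightarrow> (\<And>s. s \<in># T \<Longrightarrow> 0 \<le> s) \<Longrightarrow>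
      (\<And>x. size {#s \<in># S. s > x + w#} \<le> size {#s \<in># T. s > x#} + r) \<Longrightarrow>
      (\<And>x. size {#s \<in># T. s > x + w#} \<le> size {#s \<in># S. s > x#} + r) \<Longrightarrow> 0 \<le> w \<Longrightarrow>
      cmod ((\<Sum>s\<in>#S. F s) - (\<Sum>s\<in>#T. F s)) \<le> K * (real r + real n * w) + \<epsilon> * real n"
proof -
  obtain \<delta> m c where \<delta>: "0 < \<delta>" and app:
    "\<forall>x\<ge>0. cmod (F x - (F 0 + (\<Sum>i<m. c i * complex_of_real (ramp (x / \<delta> - real i))))) \<le> \<epsilon> / 2"
    using Cc_ramp_approximation[OF F, of "\<epsilon> / 2"] \<open>0 < \<epsilon>\<close> by (metis half_gt_zero)
  define P where "P x = F 0 + (\<Sum>i<m. c i * complex_of_real (ramp (x / \<delta> - real i)))" for x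
  have FP: "cmod ((\<Sum>s\<in>#S. F s) - (\<Sum>s\<in>#S. P s)) \<le> \<epsilon> / 2 * real (size S)"
    if "\<And>s. s \<in># S \<Longrightarrow> 0 \<le> s" for S
    using that
  proof (induction S)
    case (add y S)
    have "cmod (F y - P y) \<le> \<epsilon> / 2" using app add.prems[of y] by (simp add: P_def)
    moreover have "cmod ((\<Sum>s\<in>#S. F s) - (\<Sum>s\<in>#S. P s)) \<le> \<epsilon> / 2 * real (size S)"
      using add by auto
    moreover have "(\<Sum>s\<in>#add_mset y S. F s) - (\<Sum>s\<in>#add_mset y S. P s)
      = (F y - P y) + ((\<Sum>s\<in>#S. F s) - (\<Sum>s\<in>#S. P s))" by simp
    hence "cmod ((\<Sum>s\<in>#add_mset y S. F s) - (\<Sum>s\<in>#add_mset y S. P s))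
      \<le> cmod (F y - P y) + cmod ((\<Sum>s\<in>#S. F s) - (\<Sum>s\<in>#S. P s))"
      using norm_triangle_ineq by metis
    ultimately show ?case by (simp add: distrib_left)
  qed simp
  have Psum: "(\<Sum>s\<in>#S. P s) = of_nat (size S) * F 0
      + (\<Sum>i<m. c i * complex_of_real (\<Sum>s\<in>#S. ramp (s / \<delta> - real i)))" for S
    by (induction S) (auto simp: P_def algebra_simps sum.distrib)
  define M where "M = (\<Sum>i<m. cmod (c i))"
  have M0: "0 \<le> M" unfolding M_def by (intro sum_nonneg) auto
  \<comment> \<open>M is the total weight of the ramps. A ramp has slope 1 / \<delta>, so a shift by
    w costs w / \<delta> per term, while a displaced value costs 1; the maximum covers both.\<close>
  define K where "K = M * max 1 (1 / \<delta>)"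
  show ?thesis
  proof (rule that[of K])
    show "0 \<le> K" unfolding K_def using M0 by (intro mult_nonneg_nonneg) auto
    fix S T :: "real multiset" and n r :: nat and w :: real
    assume sz: "size S = n" "size T = n" and pos: "\<And>s. s \<in># S \<Longrightarrow> 0 \<le> s" "\<And>s. s \<in># T \<Longrightarrow> 0 \<le> s"
      and cnt: "\<And>x. size {#s \<in># S. s > x + w#} \<le> size {#s \<in># T. s > x#} + r"
        "\<And>x. size {#s \<in># T. s > x + w#} \<le> size {#s \<in># S. s > x#} + r" and w: "0 \<le> w"
    have wd: "0 \<le> w / \<delta>" using w \<delta> by simp
    have G: "mono (\<lambda>s. ramp (s / \<delta> - real i))" for i
      using \<delta> by (intro monoI ramp_mono) (simp add: divide_right_mono)
    have G': "ramp ((s + w) / \<delta> - real i) \<le> ramp (s / \<delta> - real i) + w / \<delta>" for i s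
      using wd by (auto simp: ramp_def add_divide_distrib)
    have diff: "\<bar>(\<Sum>s\<in>#S. ramp (s / \<delta> - real i)) - (\<Sum>s\<in>#T. ramp (s / \<delta> - real i))\<bar>
        \<le> real r + real n * (w / \<delta>)" for i
      using sum_mset_mono_shift_le[OF sz cnt(1) G ramp_bounds G' wd, of i]
        sum_mset_mono_shift_le[OF sz(2,1) cnt(2) G ramp_bounds G' wd, of i] by linarith
    \<comment> \<open>The constant term F 0 cancels because S and T have the same size.\<close>
    have "(\<Sum>s\<in>#S. P s) - (\<Sum>s\<in>#T. P s) = (\<Sum>i<m. c i * complex_of_real
        ((\<Sum>s\<in>#S. ramp (s / \<delta> - real i)) - (\<Sum>s\<in>#T. ramp (s / \<delta> - real i))))"
      unfolding Psum sz by (simp add: sum_subtractf right_diff_distrib)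
    also have "cmod \<dots> \<le> (\<Sum>i<m. cmod (c i) * (real r + real n * (w / \<delta>)))"
      by (intro sum_norm_le, unfold norm_mult norm_of_real, intro mult_left_mono diff norm_ge_zero)
    also have "\<dots> = M * (real r + real n * (w / \<delta>))" by (simp add: M_def sum_distrib_right)
    also have "\<dots> \<le> M * (max 1 (1 / \<delta>) * (real r + real n * w))"
    proof (intro mult_left_mono M0)
      have "1 * real r \<le> max 1 (1 / \<delta>) * real r" by (intro mult_right_mono) auto
      moreover have "1 / \<delta> * (real n * w) \<le> max 1 (1 / \<delta>) * (real n * w)"
        using w by (intro mult_right_mono) auto
      ultimately show "real r + real n * (w / \<delta>) \<le> max 1 (1 / \<delta>) * (real r + real n * w)"
        by (simp add: distrib_left)
    qed
    finally have "cmod ((\<Sum>s\<in>#S. P s) - (\<Sum>s\<in>#T. P s)) \<le> K * (real r + real n * w)"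
      by (simp add: K_def mult.assoc)
    moreover have "cmod ((\<Sum>s\<in>#S. F s) - (\<Sum>s\<in>#S. P s)) \<le> \<epsilon> / 2 * real n"
      "cmod ((\<Sum>s\<in>#T. F s) - (\<Sum>s\<in>#T. P s)) \<le> \<epsilon> / 2 * real n"
      using FP[of S] FP[of T] pos sz by auto
    moreover have "cmod (x - y) \<le> cmod (x - x') + cmod (x' - y') + cmod (y - y')" for x y x' y'
      using norm_triangle_ineq[of "x - x'" "x' - y"] norm_triangle_ineq[of "x' - y'" "y' - y"]
        norm_minus_commute[of y y'] by simp
    note this[of "\<Sum>s\<in>#S. F s" "\<Sum>s\<in>#T. F s" "\<Sum>s\<in>#S. P s" "\<Sum>s\<in>#T. P s"]
    ultimately show "cmod ((\<Sum>s\<in>#S. F s) - (\<Sum>s\<in>#T. F s)) \<le> K * (real r + real n * w) + \<epsilon> * real n"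
      by (simp add: field_simps)
  qed
qed

section \<open>Singular value distributions\<close>

lemma sing_vals_sum_stability:
  assumes F: "F \<in> Cc" and "0 < \<epsilon>"
  obtains K where "0 \<le> K"
    "\<And>m n A B R N w. B \<in> carrier_mat m n \<Longrightarrow> R \<in> carrier_mat m n \<Longrightarrow> N \<in> carrier_mat m n \<Longrightarrow>
      A = B + R + N \<Longrightarrow> spec_norm N \<le> w \<Longrightarrow>
      cmod ((\<Sum>s\<in>#sing_vals A. F s) - (\<Sum>s\<in>#sing_vals B. F s))
        \<le> K * (real (mrank R) + real (min m n) * w) + \<epsilon> * real (min m n)"
proof (rule Cc_sum_mset_stability[OF assms])
  fix K
  assume K: "0 \<le> K" and stab: "\<And>S T n w r. size S = n \<Longrightarrow> size T = n \<Longrightarrow> (\<And>s. s \<in># S \<Longrightarrow> 0 \<le> s) \<Longrightarrow> (\<And>s. s \<in># T \<Longrightarrow> 0 \<le> s) \<Longrightarrow>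
      (\<And>x. size {#s \<in># S. s > x + w#} \<le> size {#s \<in># T. s > x#} + r) \<Longrightarrow>
      (\<And>x. size {#s \<in># T. s > x + w#} \<le> size {#s \<in># S. s > x#} + r) \<Longrightarrow> 0 \<le> w \<Longrightarrow>
      cmod ((\<Sum>s\<in>#S. F s) - (\<Sum>s\<in>#T. F s)) \<le> K * (real r + real n * w) + \<epsilon> * real n"
  show thesis
  proof (rule that[OF K])
    fix m n A B R N w
    assume B: "B \<in> carrier_mat m n" and R: "R \<in> carrier_mat m n" and N: "N \<in> carrier_mat m n"
      and A: "A = B + R + N" and w: "spec_norm N \<le> w"
    have Ac: "A \<in> carrier_mat m n" using B R N A by simp
    have w0: "0 \<le> w" using w spec_norm_nonneg[of N] by linarith
    show "cmod ((\<Sum>s\<in>#sing_vals A. F s) - (\<Sum>s\<in>#sing_vals B. F s))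
        \<le> K * (real (mrank R) + real (min m n) * w) + \<epsilon> * real (min m n)"
      by (rule stab[OF size_sing_vals[OF Ac] size_sing_vals[OF B] sing_vals_nonneg sing_vals_nonneg
            sing_vals_count_perturbation[OF B R N A w] w0])
  qed
qed

lemma acs_sing_vals_distribution:
  assumes d: "\<And>n. 0 < d n" "\<And>n. 0 < d' n"
    and B: "\<And>n t. 0 < t \<Longrightarrow> B n t \<in> carrier_mat (d n) (d' n)"
    and acs: "acs B A d d'" and F: "F \<in> Cc"
    and B_lim: "\<And>t. 0 < t \<Longrightarrow> (\<lambda>n. (\<Sum>x\<in>#sing_vals (B n t). F x) / of_nat (min (d n) (d' n))) \<longlonglongrightarrow> \<beta> t"
    and \<beta>: "\<beta> \<longlonglongrightarrow> \<alpha>"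
  shows "(\<lambda>n. (\<Sum>x\<in>#sing_vals (A n). F x) / of_nat (min (d n) (d' n))) \<longlonglongrightarrow> \<alpha>"
proof (rule LIMSEQ_I)
  fix e :: real assume "0 < e"
  hence e4: "0 < e / 4" by simp
  obtain c \<omega> :: "nat \<Rightarrow> real" where c: "c \<longlonglongrightarrow> 0" and \<omega>: "\<omega> \<longlonglongrightarrow> 0"
    and split: "\<forall>t>0. \<exists>nt. \<forall>n>nt. \<exists>R Nm. R \<in> carrier_mat (d n) (d' n) \<and> Nm \<in> carrier_mat (d n) (d' n) \<and>
            A n = B n t + R + Nm \<and> real (mrank R) \<le> c t * real (min (d n) (d' n)) \<and> spec_norm Nm \<le> \<omega> t"
    using acs unfolding acs_def by blast
  obtain K where K: "0 \<le> K" and stab: "\<And>m n A B R N w. B \<in> carrier_mat m n \<Longrightarrow> R \<in> carrier_mat m n \<Longrightarrow> N \<in> carrier_mat m n \<Longrightarrow>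
      A = B + R + N \<Longrightarrow> spec_norm N \<le> w \<Longrightarrow>
      cmod ((\<Sum>s\<in>#sing_vals A. F s) - (\<Sum>s\<in>#sing_vals B. F s))
        \<le> K * (real (mrank R) + real (min m n) * w) + e / 4 * real (min m n)"
    using sing_vals_sum_stability[OF F e4] by metis
  have "(\<lambda>t. K * (c t + \<omega> t)) \<longlonglongrightarrow> K * (0 + 0)" by (intro tendsto_intros c \<omega>)
  hence "\<forall>\<^sub>F t in sequentially. K * (c t + \<omega> t) < e / 4" using e4 by (intro order_tendstoD(2)) auto
  moreover have "\<forall>\<^sub>F t in sequentially. cmod (\<beta> t - \<alpha>) < e / 4"
    using tendstoD[OF \<beta> e4] by (simp add: dist_norm)
  ultimately have "\<forall>\<^sub>F t in sequentially. K * (c t + \<omega> t) < e / 4 \<and> cmod (\<beta> t - \<alpha>) < e / 4 \<and> 0 < t"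
    using eventually_gt_at_top[of 0] by eventually_elim auto
  \<comment> \<open>K is already fixed here, and t is fixed before n, since both \<open>nt\<close>
    and the speed of convergence of the averages of \<open>B n t\<close> depend on t.\<close>
  then obtain t where t: "K * (c t + \<omega> t) < e / 4" "cmod (\<beta> t - \<alpha>) < e / 4" "0 < t"
    using eventually_happens'[OF sequentially_bot] by blast
  obtain nt where nt: "\<And>n. n > nt \<Longrightarrow> \<exists>R Nm. R \<in> carrier_mat (d n) (d' n) \<and> Nm \<in> carrier_mat (d n) (d' n) \<and>
            A n = B n t + R + Nm \<and> real (mrank R) \<le> c t * real (min (d n) (d' n)) \<and> spec_norm Nm \<le> \<omega> t"
    using split t(3) by blast
  obtain n0 where n0: "\<And>n. n \<ge> n0 \<Longrightarrow> cmod ((\<Sum>x\<in>#sing_vals (B n t). F x) / of_nat (min (d n) (d' n)) - \<beta> t) < e / 4"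
    using LIMSEQ_D[OF B_lim[OF t(3)] e4] by blast
  show "\<exists>no. \<forall>n\<ge>no. cmod ((\<Sum>x\<in>#sing_vals (A n). F x) / of_nat (min (d n) (d' n)) - \<alpha>) < e"
  proof (intro exI allI impI)
    fix n assume n: "n \<ge> max n0 (Suc nt)"
    define p where "p = min (d n) (d' n)"
    have p: "0 < real p" using d by (simp add: p_def)
    let ?a = "\<Sum>x\<in>#sing_vals (A n). F x" and ?b = "\<Sum>x\<in>#sing_vals (B n t). F x"
    obtain R Nm where R: "R \<in> carrier_mat (d n) (d' n)" and Nm: "Nm \<in> carrier_mat (d n) (d' n)"
      and eq: "A n = B n t + R + Nm" and rk: "real (mrank R) \<le> c t * real p" and sn: "spec_norm Nm \<le> \<omega> t"
      using nt[of n] n by (auto simp: p_def)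
    have "cmod (?a - ?b) \<le> K * (real (mrank R) + real p * \<omega> t) + e / 4 * real p"
      unfolding p_def by (rule stab[OF B[OF t(3)] R Nm eq sn])
    also have "\<dots> \<le> K * (c t * real p + real p * \<omega> t) + e / 4 * real p"
      using rk K by (intro add_right_mono mult_left_mono) auto
    also have "\<dots> = (K * (c t + \<omega> t) + e / 4) * real p" by (simp add: algebra_simps)
    also have "\<dots> < (e / 4 + e / 4) * real p" using t(1) p by (intro mult_strict_right_mono) auto
    finally have "cmod (?a / of_nat p - ?b / of_nat p) < e / 4 + e / 4"
      using p by (simp add: diff_divide_distrib[symmetric] norm_divide pos_divide_less_eq)
    moreover have "cmod (?b / of_nat p - \<beta> t) < e / 4" using n0[of n] n by (simp add: p_def)
    moreover have "cmod (?a / of_nat p - \<alpha>) \<le> cmod (?a / of_nat p - ?b / of_nat p) + cmod (?b / of_nat p - \<beta> t) + cmod (\<beta> t - \<alpha>)"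
      using norm_triangle_ineq[of "?a / of_nat p - ?b / of_nat p" "?b / of_nat p - \<alpha>"]
        norm_triangle_ineq[of "?b / of_nat p - \<beta> t" "\<beta> t - \<alpha>"] by simp
    ultimately show "cmod (?a / of_nat (min (d n) (d' n)) - \<alpha>) < e"
      using t(2) unfolding p_def[symmetric] by linarith
  qed
qed

text \<open>X k is Y perturbed by a matrix of rank 0 and by X k - Y, whose spectral norm is at most
  the sum of the moduli of its entries. Sums over the whole multiset avoid any choice of continuous
  branches of singular values.\<close>

lemma sv_avg_tendsto:
  assumes F: "F \<in> Cc" and p: "0 < p1" "0 < p2"
    and X: "\<And>k. X k \<in> carrier_mat p1 p2" and Y: "Y \<in> carrier_mat p1 p2"
    and lim: "\<And>i j. i < p1 \<Longrightarrow> j < p2 \<Longrightarrow> (\<lambda>k. X k $$ (i,j)) \<longlonglongrightarrow> Y $$ (i,j)"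
  shows "(\<lambda>k. sv_avg F (X k)) \<longlonglongrightarrow> sv_avg F Y"
proof (rule tendstoI)
  fix e :: real assume "0 < e"
  hence e2: "0 < e / 2" by simp
  define q where "q = min p1 p2"
  have q: "0 < real q" using p by (simp add: q_def)
  obtain K where K: "0 \<le> K" and stab: "\<And>m n A B R N w. B \<in> carrier_mat m n \<Longrightarrow> R \<in> carrier_mat m n \<Longrightarrow> N \<in> carrier_mat m n \<Longrightarrow>
      A = B + R + N \<Longrightarrow> spec_norm N \<le> w \<Longrightarrow>
      cmod ((\<Sum>s\<in>#sing_vals A. F s) - (\<Sum>s\<in>#sing_vals B. F s))
        \<le> K * (real (mrank R) + real (min m n) * w) + e / 2 * real (min m n)"
    using sing_vals_sum_stability[OF F e2] by metis
  define w where "w k = (\<Sum>i<p1. \<Sum>j<p2. cmod ((X k - Y) $$ (i,j)))" for k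
  have "w \<longlonglongrightarrow> (\<Sum>i<p1. \<Sum>j<p2. 0)"
    unfolding w_def
  proof (intro tendsto_sum)
    fix i j assume "i \<in> {..<p1}" "j \<in> {..<p2}"
    hence ij: "i < p1" "j < p2" by auto
    have "(\<lambda>k. cmod (X k $$ (i,j) - Y $$ (i,j))) \<longlonglongrightarrow> cmod (Y $$ (i,j) - Y $$ (i,j))"
      by (intro tendsto_intros lim ij)
    thus "(\<lambda>k. cmod ((X k - Y) $$ (i,j))) \<longlonglongrightarrow> 0" using ij Y X by simp
  qed
  hence "(\<lambda>k. K * w k) \<longlonglongrightarrow> K * 0" by (intro tendsto_intros) simp
  hence "\<forall>\<^sub>F k in sequentially. K * w k < e / 2" using e2 by (intro order_tendstoD(2)) auto
  thus "\<forall>\<^sub>F k in sequentially. dist (sv_avg F (X k)) (sv_avg F Y) < e"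
  proof eventually_elim
    case (elim k)
    let ?a = "\<Sum>x\<in>#sing_vals (X k). F x" and ?b = "\<Sum>x\<in>#sing_vals Y. F x"
    have N: "X k - Y \<in> carrier_mat p1 p2" by (rule minus_carrier_mat[OF Y])
    have eq: "X k = Y + 0\<^sub>m p1 p2 + (X k - Y)" using X[of k] Y by (intro eq_matI) auto
    have rk: "mrank (0\<^sub>m p1 p2) = 0" by (simp add: mrank_def vec_space.rank_0I)
    have "cmod (?a - ?b) \<le> K * (real (mrank (0\<^sub>m p1 p2)) + real q * w k) + e / 2 * real q"
      unfolding q_def w_def by (rule stab[OF Y zero_carrier_mat N eq spec_norm_le_entries[OF N]])
    also have "\<dots> = (K * w k + e / 2) * real q" by (simp add: rk algebra_simps)
    also have "\<dots> < (e / 2 + e / 2) * real q" using elim q by (intro mult_strict_right_mono) auto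
    finally have "cmod (?a / of_nat q - ?b / of_nat q) < e"
      using q by (simp add: diff_divide_distrib[symmetric] norm_divide pos_divide_less_eq)
    thus ?case using X[of k] Y by (simp add: dist_norm sv_avg_def q_def)
  qed
qed

section \<open>Boundedness and measurability of singular value averages\<close>

lemma Cc_bounded:
  assumes "F \<in> Cc"
  obtains M where "0 \<le> M" "\<And>x. cmod (F x) \<le> M"
proof -
  have "compact (F ` closure {x. F x \<noteq> 0})"
    using assms by (auto simp: Cc_def intro!: compact_continuous_image elim: continuous_on_subset)
  then obtain M where M: "\<forall>y\<in>F ` closure {x. F x \<noteq> 0}. cmod y \<le> M"
    using compact_imp_bounded bounded_iff by metis
  have "cmod (F x) \<le> max M 0" for x
    using M closure_subset[of "{x. F x \<noteq> 0}"] by (cases "F x = 0") (auto simp: subset_iff le_max_iff_disj)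
  thus ?thesis using that[of "max M 0"] by simp
qed

lemma norm_sv_avg_le:
  assumes "0 \<le> M" "\<And>x. cmod (F x) \<le> M"
  shows "cmod (sv_avg F X) \<le> M"
proof -
  define p where "p = min (dim_row X) (dim_col X)"
  have "cmod (\<Sum>x\<in>#S. F x) \<le> M * real (size S)" for S
  proof (induction S)
    case (add x S)
    show ?case using norm_triangle_ineq[of "F x" "\<Sum>x\<in>#S. F x"] add assms(2)[of x] by (simp add: distrib_left)
  qed simp
  hence "cmod (\<Sum>x\<in>#sing_vals X. F x) \<le> M * real p"
    using size_sing_vals[of X "dim_row X" "dim_col X"] by (metis carrier_matI p_def)
  thus ?thesis using assms(1)
    by (cases "p = 0") (simp_all add: sv_avg_def p_def[symmetric] norm_divide pos_divide_le_eq)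
qed

text \<open>Simple functions need only finitely many values and measurable fibres, hence no
  \<sigma>-algebra on matrices, and any function of a simple function is simple. So
  \<open>sv_avg F\<close> may be applied before anything is known about its measurability.\<close>

lemma simple_function_mat:
  assumes "\<And>i j. i < p1 \<Longrightarrow> j < p2 \<Longrightarrow> simple_function M (G i j)"
  shows "simple_function M (\<lambda>s. mat p1 p2 (\<lambda>(i,j). G i j s))"
proof -
  let ?I = "{..<p1} \<times> {..<p2}" and ?X = "\<lambda>s. mat p1 p2 (\<lambda>(i,j). G i j s)"
  have "?X ` space M \<subseteq> mat p1 p2 ` (\<Pi>\<^sub>E (i,j)\<in>?I. G i j ` space M)"
  proof (rule image_subsetI)
    fix s assume "s \<in> space M"
    hence "restrict (\<lambda>(i,j). G i j s) ?I \<in> (\<Pi>\<^sub>E (i,j)\<in>?I. G i j ` space M)" by auto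
    moreover have "?X s = mat p1 p2 (restrict (\<lambda>(i,j). G i j s) ?I)" by (intro eq_matI) auto
    ultimately show "?X s \<in> mat p1 p2 ` (\<Pi>\<^sub>E (i,j)\<in>?I. G i j ` space M)" by blast
  qed
  moreover have "finite (\<Pi>\<^sub>E (i,j)\<in>?I. G i j ` space M)"
    using simple_functionD(1)[OF assms] by (intro finite_PiE) auto
  ultimately have fin: "finite (?X ` space M)" by (meson finite_imageI finite_subset)
  have "?X -` {?X u} \<inter> space M \<in> sets M" for u
  proof -
    have "?X -` {?X u} \<inter> space M = {s\<in>space M. \<forall>ij\<in>?I. G (fst ij) (snd ij) s = G (fst ij) (snd ij) u}"
      by (auto simp: mat_eq_iff)
    also have "\<dots> \<in> sets M"
    proof (rule sets.sets_Collect_finite_All)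
      fix ij assume "ij \<in> ?I"
      hence "G (fst ij) (snd ij) -` {G (fst ij) (snd ij) u} \<inter> space M \<in> sets M"
        by (intro simple_functionD(2) assms) auto
      moreover have "G (fst ij) (snd ij) -` {G (fst ij) (snd ij) u} \<inter> space M
        = {s\<in>space M. G (fst ij) (snd ij) s = G (fst ij) (snd ij) u}" by auto
      ultimately show "{s\<in>space M. G (fst ij) (snd ij) s = G (fst ij) (snd ij) u} \<in> sets M" by simp
    qed simp
    finally show ?thesis .
  qed
  with fin show ?thesis unfolding simple_function_def by auto
qed

text \<open>The entries are limits of simple functions; \<open>sv_avg F\<close> of the approximating
  matrices is simple, and it converges by \<open>sv_avg_tendsto\<close>.\<close>

lemma sv_avg_measurable:
  assumes F: "F \<in> Cc" and p: "0 < p1" "0 < p2" and S: "S \<in> sets lebesgue"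
    and g: "mat_measurable_on S p1 p2 g"
  shows "set_borel_measurable lebesgue S (\<lambda>s. sv_avg F (g s))"
proof -
  define h where "h i j s = indicat_real S s *\<^sub>R g s $$ (i,j)" for i j s
  have "\<exists>G. (\<forall>k. simple_function lebesgue (G k)) \<and> (\<forall>s. (\<lambda>k. G k s) \<longlonglongrightarrow> h i j s)"
    if "i < p1" "j < p2" for i j
  proof -
    have "h i j \<in> borel_measurable lebesgue"
      using g that unfolding mat_measurable_on_def set_borel_measurable_def h_def by auto
    from borel_measurable_implies_sequence_metric[OF this, of 0] show ?thesis by auto
  qed
  then obtain G where G: "\<And>i j k. i < p1 \<Longrightarrow> j < p2 \<Longrightarrow> simple_function lebesgue (G i j k)"
    "\<And>i j s. i < p1 \<Longrightarrow> j < p2 \<Longrightarrow> (\<lambda>k. G i j k s) \<longlonglongrightarrow> h i j s"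
    by metis
  have "(\<lambda>s. sv_avg F (mat p1 p2 (\<lambda>(i,j). h i j s))) \<in> borel_measurable lebesgue"
  proof (rule borel_measurable_LIMSEQ_metric)
    fix k
    have "simple_function lebesgue (\<lambda>s. mat p1 p2 (\<lambda>(i,j). G i j k s))"
      by (intro simple_function_mat G)
    hence "simple_function lebesgue (sv_avg F \<circ> (\<lambda>s. mat p1 p2 (\<lambda>(i,j). G i j k s)))"
      by (rule simple_function_compose)
    thus "(\<lambda>s. sv_avg F (mat p1 p2 (\<lambda>(i,j). G i j k s))) \<in> borel_measurable lebesgue"
      by (auto simp: o_def intro: borel_measurable_simple_function)
  next
    fix s
    show "(\<lambda>k. sv_avg F (mat p1 p2 (\<lambda>(i,j). G i j k s))) \<longlonglongrightarrow> sv_avg F (mat p1 p2 (\<lambda>(i,j). h i j s))"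
      by (rule sv_avg_tendsto[OF F p]) (auto simp: G)
  qed
  \<comment> \<open>Outside S the matrix of the \<open>h i j s\<close> is zero and its average is F
    0, which may be nonzero; the indicator removes it.\<close>
  hence "(\<lambda>s. indicat_real S s *\<^sub>R sv_avg F (mat p1 p2 (\<lambda>(i,j). h i j s))) \<in> borel_measurable lebesgue"
    using S by (intro borel_measurable_scaleR borel_measurable_indicator)
  moreover have "indicat_real S s *\<^sub>R sv_avg F (mat p1 p2 (\<lambda>(i,j). h i j s)) = indicat_real S s *\<^sub>R sv_avg F (g s)" for s
  proof (cases "s \<in> S")
    case True
    hence "g s \<in> carrier_mat p1 p2" using g by (simp add: mat_measurable_on_def)
    hence "mat p1 p2 (\<lambda>(i,j). h i j s) = g s" using True by (intro eq_matI) (auto simp: h_def)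
    thus ?thesis by simp
  qed simp
  ultimately show ?thesis unfolding set_borel_measurable_def by simp
qed

lemma sv_avg_integral_tendsto:
  fixes D :: "'d::euclidean_space set"
  assumes F: "F \<in> Cc" and p: "0 < p1" "0 < p2"
    and D: "D \<in> sets lebesgue" "emeasure lebesgue D < \<infinity>" and f: "mat_measurable_on D p1 p2 f"
    and E: "\<And>t. E t \<in> sets lebesgue" "incseq E" "(\<Union>t. E t) = D"
    and g: "\<And>t. mat_measurable_on (E t) p1 p2 (g t)"
    and lim: "AE s in lebesgue. s \<in> D \<longrightarrow> (\<forall>i<p1. \<forall>j<p2.
      (\<lambda>t. (if s \<in> E t then g t s else 0\<^sub>m p1 p2) $$ (i,j)) \<longlonglongrightarrow> f s $$ (i,j))"
  shows "(\<lambda>t. LINT s:E t|lebesgue. sv_avg F (g t s)) \<longlonglongrightarrow> (LINT s:D|lebesgue. sv_avg F (f s))"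
proof -
  obtain M where M: "0 \<le> M" "\<And>x. cmod (F x) \<le> M" using Cc_bounded[OF F] by metis
  show ?thesis
    unfolding set_lebesgue_integral_def
  proof (rule integral_dominated_convergence[where w = "\<lambda>s. indicat_real D s * M"])
    show "(\<lambda>s. indicat_real D s *\<^sub>R sv_avg F (f s)) \<in> borel_measurable lebesgue"
      using sv_avg_measurable[OF F p D(1) f] by (simp add: set_borel_measurable_def)
    show "(\<lambda>s. indicat_real (E t) s *\<^sub>R sv_avg F (g t s)) \<in> borel_measurable lebesgue" for t
      using sv_avg_measurable[OF F p E(1) g] by (simp add: set_borel_measurable_def)
    show "integrable lebesgue (\<lambda>s. indicat_real D s * M)"
      using D by (intro integrable_mult_left integrable_real_indicator)
    show "AE s in lebesgue. norm (indicat_real (E t) s *\<^sub>R sv_avg F (g t s)) \<le> indicat_real D s * M" for t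
    proof (rule AE_I2)
      fix s
      have "E t \<subseteq> D" using E(3) by auto
      thus "norm (indicat_real (E t) s *\<^sub>R sv_avg F (g t s)) \<le> indicat_real D s * M"
        using norm_sv_avg_le[of M F "g t s", OF M] M(1) by (auto simp: indicator_def)
    qed
    show "AE s in lebesgue. (\<lambda>t. indicat_real (E t) s *\<^sub>R sv_avg F (g t s)) \<longlonglongrightarrow> indicat_real D s *\<^sub>R sv_avg F (f s)"
      using lim
    proof eventually_elim
      case (elim s)
      show ?case
      proof (cases "s \<in> D")
        case False
        hence "s \<notin> E t" for t using E(3) by auto
        thus ?thesis using False by simp
      next
        case True
        then obtain t0 where "s \<in> E t0" using E(3) by auto
        hence "s \<in> E t" if "t \<ge> t0" for t using incseqD[OF E(2) that] by auto
        \<comment> \<open>The two sides can differ as long as s is outside \<open>E t\<close>: the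
          zero matrix has average F 0, the integrand is 0. As s stays in \<open>E t\<close> from t0
          on, the limits agree.\<close>
        hence ev: "\<forall>\<^sub>F t in sequentially. sv_avg F (if s \<in> E t then g t s else 0\<^sub>m p1 p2)
            = indicat_real (E t) s *\<^sub>R sv_avg F (g t s)"
          by (intro eventually_sequentiallyI[of t0]) simp
        have "(\<lambda>t. sv_avg F (if s \<in> E t then g t s else 0\<^sub>m p1 p2)) \<longlonglongrightarrow> sv_avg F (f s)"
          using elim True g f by (intro sv_avg_tendsto[OF F p]) (auto simp: mat_measurable_on_def)
        thus ?thesis using True Lim_transform_eventually[OF _ ev] by simp
      qed
    qed
  qed
qed

theorem theorem4p1:
  fixes A :: "nat \<Rightarrow> complex mat" and d d' :: "nat \<Rightarrow> nat"
    and D :: "'d::euclidean_space set" and f :: "'d \<Rightarrow> complex mat" and p1 p2 :: nat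
    and Dt :: "nat \<Rightarrow> 'd set" and B :: "nat \<Rightarrow> nat \<Rightarrow> complex mat"
    and ft :: "nat \<Rightarrow> 'd \<Rightarrow> complex mat" and \<alpha> :: "(real \<Rightarrow> complex) \<Rightarrow> complex"
  assumes dims: "incseq d" "incseq d'" "\<And>n. d n > 0" "\<And>n. d' n > 0"
    and A_dim: "\<And>n. A n \<in> carrier_mat (d n) (d' n)"
    and D_meas: "D \<in> sets lebesgue"
    and p_pos: "p1 \<ge> 1" "p2 \<ge> 1"
    and f_meas: "mat_measurable_on D p1 p2 f"
    and Dt_meas: "\<And>t. t > 0 \<Longrightarrow> Dt t \<in> sets lebesgue"
    and Dt_mono: "\<And>t. t > 0 \<Longrightarrow> Dt t \<subseteq> Dt (t + 1)"
    and Dt_union: "(\<Union>t\<in>{0<..}. Dt t) = D"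
    and B_dim: "\<And>n t. t > 0 \<Longrightarrow> B n t \<in> carrier_mat (d n) (d' n)"
    and B_acs: "acs B A d d'"
    and ft_meas: "\<And>t. t > 0 \<Longrightarrow> mat_measurable_on (Dt t) p1 p2 (ft t)"
    and Dt_pos: "\<And>t. t > 0 \<Longrightarrow> 0 < measure lebesgue (Dt t) \<and> emeasure lebesgue (Dt t) < \<infinity>"
    and B_distr: "\<And>t F. t > 0 \<Longrightarrow> F \<in> Cc \<Longrightarrow>
        (\<lambda>n. (\<Sum>x\<in>#sing_vals (B n t). F x) / of_nat (min (d n) (d' n)))
          \<longlonglongrightarrow> (LINT s:Dt t|lebesgue. sv_avg F (ft t s)) / of_real (measure lebesgue (Dt t))"
    and alpha_lim: "\<And>F. F \<in> Cc \<Longrightarrow>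
        (\<lambda>t. (LINT s:Dt t|lebesgue. sv_avg F (ft t s)) / of_real (measure lebesgue (Dt t)))
          \<longlonglongrightarrow> \<alpha> F"
  shows "(\<forall>F\<in>Cc. (\<lambda>n. (\<Sum>x\<in>#sing_vals (A n). F x) / of_nat (min (d n) (d' n))) \<longlonglongrightarrow> \<alpha> F)
    \<and> ((AE s in lebesgue. s \<in> D \<longrightarrow>
           (\<forall>i<p1. \<forall>j<p2. (\<lambda>t. (if s \<in> Dt t then ft t s else 0\<^sub>m p1 p2) $$ (i,j)) \<longlonglongrightarrow> f s $$ (i,j)))
        \<and> emeasure lebesgue D < \<infinity>
       \<longrightarrow> (\<forall>F\<in>Cc. \<alpha> F = (LINT s:D|lebesgue. sv_avg F (f s)) / of_real (measure lebesgue D)))"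
proof (intro conjI ballI impI)
  fix F assume F: "F \<in> Cc"
  show "(\<lambda>n. (\<Sum>x\<in>#sing_vals (A n). F x) / of_nat (min (d n) (d' n))) \<longlonglongrightarrow> \<alpha> F"
    by (rule acs_sing_vals_distribution[OF dims(3,4) B_dim B_acs F B_distr[OF _ F] alpha_lim[OF F]])
next
  fix F assume F: "F \<in> Cc"
  assume "(AE s in lebesgue. s \<in> D \<longrightarrow>
           (\<forall>i<p1. \<forall>j<p2. (\<lambda>t. (if s \<in> Dt t then ft t s else 0\<^sub>m p1 p2) $$ (i,j)) \<longlonglongrightarrow> f s $$ (i,j)))
        \<and> emeasure lebesgue D < \<infinity>"
  hence ae: "AE s in lebesgue. s \<in> D \<longrightarrow>
           (\<forall>i<p1. \<forall>j<p2. (\<lambda>t. (if s \<in> Dt t then ft t s else 0\<^sub>m p1 p2) $$ (i,j)) \<longlonglongrightarrow> f s $$ (i,j))"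
    and fin: "emeasure lebesgue D < \<infinity>" by auto
  \<comment> \<open>The hypotheses concern t > 0 only, and \<open>Dt 0\<close> is arbitrary; the
    shift gives an increasing sequence indexed from 0.\<close>
  define E where "E t = Dt (Suc t)" for t
  have E: "E t \<in> sets lebesgue" for t using Dt_meas by (simp add: E_def)
  have incE: "incseq E" using Dt_mono[of "Suc _"] by (intro incseq_SucI) (simp add: E_def)
  have UE: "(\<Union>t. E t) = D"
    unfolding Dt_union[symmetric] E_def by (force simp: gr0_conv_Suc)
  have "AE s in lebesgue. s \<in> D \<longrightarrow>
      (\<forall>i<p1. \<forall>j<p2. (\<lambda>t. (if s \<in> E t then ft (Suc t) s else 0\<^sub>m p1 p2) $$ (i,j)) \<longlonglongrightarrow> f s $$ (i,j))"
    using ae by eventually_elim (auto simp: E_def dest: LIMSEQ_Suc)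
  hence int: "(\<lambda>t. LINT s:E t|lebesgue. sv_avg F (ft (Suc t) s)) \<longlonglongrightarrow> (LINT s:D|lebesgue. sv_avg F (f s))"
    using p_pos ft_meas
    by (intro sv_avg_integral_tendsto[OF F _ _ D_meas fin f_meas E incE UE]) (auto simp: E_def)
  have meas: "(\<lambda>t. measure lebesgue (E t)) \<longlonglongrightarrow> measure lebesgue D"
  proof -
    have "range E \<subseteq> sets lebesgue" using E by blast
    moreover have "emeasure lebesgue (\<Union>t. E t) \<noteq> \<infinity>" using fin by (metis UE less_irrefl)
    ultimately show ?thesis using Lim_measure_incseq[OF _ incE] UE by metis
  qed
  \<comment> \<open>The quotient of the two limits requires a nonzero measure of D, which is
    inherited from \<open>Dt 1\<close>.\<close>
  have "measure lebesgue (E 0) \<le> measure lebesgue D"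
    using E D_meas UE fin by (intro measure_mono_fmeasurable) (auto simp: fmeasurable_def)
  hence "measure lebesgue D \<noteq> 0" using Dt_pos[of 1] by (auto simp: E_def)
  hence "(\<lambda>t. (LINT s:Dt (Suc t)|lebesgue. sv_avg F (ft (Suc t) s)) / of_real (measure lebesgue (Dt (Suc t))))
      \<longlonglongrightarrow> (LINT s:D|lebesgue. sv_avg F (f s)) / of_real (measure lebesgue D)"
    using int meas unfolding E_def by (intro tendsto_intros) auto
  thus "\<alpha> F = (LINT s:D|lebesgue. sv_avg F (f s)) / of_real (measure lebesgue D)"
    using LIMSEQ_unique LIMSEQ_Suc[OF alpha_lim[OF F]] by blast
qed

end
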